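(* Let $\mathcal T$ be a compactly generated triangulated category and let $\phi(x_A)$ be a pp formula in the language for $\mathcal T$, with free variable $x_A$ of sort $A\in\mathcal T^{\rm c}$. Choose a morphism $f:A\to B$ in $\mathcal T^{\rm c}$ such that $\phi$ is equivalent on $\mathcal T$ to $f\mid x_A$ (such an $f$ exists). Then $(B,f)$ is a free realisation of $\phi$.
   Context: $\mathcal T$ is a triangulated category with arbitrary coproducts. An object $A$ is compact if $\mathrm{Hom}(A,-)$ commutes with coproducts; $\mathcal T^{\rm c}$ is the full subcategory of compact objects. Compactly generated means that $\mathcal T^{\rm c}$ has only a set of isomorphism classes and that $\mathrm{Hom}(A,X)=0$ for all compact $A$ implies $X=0$. We write $(X,Y)=\mathrm{Hom}_{\mathcal T}(X,Y)$. Language for $\mathcal T$: there is one sort for each object $A$ of (a small version of) $\mathcal T^{\rm c}$. For $X\in\mathcal T$, the elements of $X$ of sort $A$ are the morphisms $A\to X$. The language has addition and zero on each sort and, for each $f:A\to B$ in $\mathcal T^{\rm c}$, a function symbol from sort $B$ to sort $A$ interpreted in $X$ by $b\mapsto bf$. A pp formula is one obtained from a finite system of linear equations (with coefficients morphisms of $\mathcal T^{\rm c}$) by existentially quantifying some variables; $\phi(X)$ denotes its solution set in $X$. For $f:A\to B$ in $\mathcal T^{\rm c}$, $f\mid x_A$ denotes $\exists y_B\,(x_A=y_B f)$. Two pp formulas in the same free variables are equivalent on $\mathcal T$ if they have the same solution set in every $X\in\mathcal T$; $\phi\le\psi$ means $\phi(X)\subseteq\psi(X)$ for every $X\in\mathcal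 T$. The pp-type of an element $a:A\to X$ is $\mathrm{pp}^X(a)=\{\psi \text{ pp}: a\in\psi(X)\}$, and $\langle\phi\rangle=\{\psi\text{ pp}:\phi\le\psi\}$. A free realisation of $\phi(x_A)$ is a pair $(C,c)$ with $C\in\mathcal T^{\rm c}$ and $c:A\to C$ such that $\mathrm{pp}^C(c)=\langle\phi\rangle$. *)

theory Defs
  imports "HOL-Algebra.Free_Abelian_Groups" "HOL-Library.Equipollence"
begin

section \<open>Triangulated categories\<close>

text \<open>
  Composition is written in the usual (right-to-left) order: \<open>g \<cdot> f\<close> is \<open>g\<close> after \<open>f\<close>.
  The field \<open>triangles\<close> contains a triple \<open>(u, v, w)\<close> for each distinguished triangle
  \<open>X \<rightarrow> Y \<rightarrow> Z \<rightarrow> \<Sigma>X\<close>; the objects are recovered from the arrows.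
\<close>

record ('o, 'm) precategory =
  obj :: "'o set"
  arr :: "'m set"
  src :: "'m \<Rightarrow> 'o"
  tgt :: "'m \<Rightarrow> 'o"
  ident :: "'o \<Rightarrow> 'm"
  cmp :: "'m \<Rightarrow> 'm \<Rightarrow> 'm" (infixl \<open>\<cdot>\<index>\<close> 70)

record ('o, 'm) preadditive_precategory = "('o, 'm) precategory" +
  hplus :: "'m \<Rightarrow> 'm \<Rightarrow> 'm" (infixl \<open>\<boxplus>\<index>\<close> 65)
  hzero :: "'o \<Rightarrow> 'o \<Rightarrow> 'm"

record ('o, 'm) pretriangulation = "('o, 'm) preadditive_precategory" +
  shift_obj :: "'o \<Rightarrow> 'o"
  shift :: "'m \<Rightarrow> 'm"
  triangles :: "('m \<times> 'm \<times> 'm) set"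

definition homset :: "('o, 'm, 'z) precategory_scheme \<Rightarrow> 'o \<Rightarrow> 'o \<Rightarrow> 'm set" where
  "homset T A B = {f \<in> arr T. src T f = A \<and> tgt T f = B}"

locale category =
  fixes T :: "('o, 'm, 'z) precategory_scheme" (structure)
  assumes src_obj: "f \<in> arr T \<Longrightarrow> src T f \<in> obj T"
    and tgt_obj: "f \<in> arr T \<Longrightarrow> tgt T f \<in> obj T"
    and ident_hom: "A \<in> obj T \<Longrightarrow> ident T A \<in> homset T A A"
    and cmp_hom: "\<lbrakk>f \<in> homset T A B; g \<in> homset T B C\<rbrakk> \<Longrightarrow> g \<cdot> f \<in> homset T A C"
    and cmp_ident_right: "f \<in> homset T A B \<Longrightarrow> f \<cdot> ident T A = f"
    and cmp_ident_left: "f \<in> homset T A B \<Longrightarrow> ident T B \<cdot> f = f"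
    and cmp_assoc: "\<lbrakk>f \<in> homset T A B; g \<in> homset T B C; h \<in> homset T C D\<rbrakk>
        \<Longrightarrow> h \<cdot> (g \<cdot> f) = (h \<cdot> g) \<cdot> f"

definition is_zero_object :: "('o, 'm, 'z) precategory_scheme \<Rightarrow> 'o \<Rightarrow> bool" where
  "is_zero_object T Z \<longleftrightarrow>
     Z \<in> obj T \<and> (\<forall>X\<in>obj T. (\<exists>!f. f \<in> homset T Z X) \<and> (\<exists>!f. f \<in> homset T X Z))"

definition is_isomorphism :: "('o, 'm, 'z) precategory_scheme \<Rightarrow> 'o \<Rightarrow> 'o \<Rightarrow> 'm \<Rightarrow> bool" where
  "is_isomorphism T A B f \<longleftrightarrow> f \<in> homset T A B \<and>
     (\<exists>g\<in>homset T B A. cmp T g f = ident T A \<and> cmp T f g = ident T B)"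

definition isomorphic :: "('o, 'm, 'z) precategory_scheme \<Rightarrow> 'o \<Rightarrow> 'o \<Rightarrow> bool" where
  "isomorphic T A B \<longleftrightarrow> (\<exists>f. is_isomorphism T A B f)"

text \<open>\<open>P\<close> together with the morphisms \<open>\<iota> i : X i \<rightarrow> P\<close> is a coproduct of the family \<open>X\<close>
  indexed by \<open>I\<close>.\<close>

definition is_coproduct ::
  "('o, 'm, 'z) precategory_scheme \<Rightarrow> 'i set \<Rightarrow> ('i \<Rightarrow> 'o) \<Rightarrow> 'o \<Rightarrow> ('i \<Rightarrow> 'm) \<Rightarrow> bool" where
  "is_coproduct T I X P \<iota> \<longleftrightarrow> P \<in> obj T \<and> (\<forall>i\<in>I. \<iota> i \<in> homset T (X i) P) \<and>
     (\<forall>Y\<in>obj T. \<forall>g. (\<forall>i\<in>I. g i \<in> homset T (X i) Y) \<longrightarrow>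
        (\<exists>!h. h \<in> homset T P Y \<and> (\<forall>i\<in>I. cmp T h (\<iota> i) = g i)))"

definition hom_group ::
  "('o, 'm, 'z) preadditive_precategory_scheme \<Rightarrow> 'o \<Rightarrow> 'o \<Rightarrow> 'm monoid" where
  "hom_group T A B =
     \<lparr>carrier = homset T A B, monoid.mult = hplus T, monoid.one = hzero T A B\<rparr>"

definition hneg :: "('o, 'm, 'z) preadditive_precategory_scheme \<Rightarrow> 'm \<Rightarrow> 'm" where
  "hneg T f = inv\<^bsub>hom_group T (src T f) (tgt T f)\<^esub> f"

locale additive_category = category T
  for T :: "('o, 'm, 'z) preadditive_precategory_scheme" (structure) +
  assumes hom_comm_group: "\<lbrakk>A \<in> obj T; B \<in> obj T\<rbrakk> \<Longrightarrow> comm_group (hom_group T A B)"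
    and cmp_hplus_left: "\<lbrakk>f \<in> homset T A B; g \<in> homset T B C; h \<in> homset T B C\<rbrakk>
        \<Longrightarrow> (g \<boxplus> h) \<cdot> f = g \<cdot> f \<boxplus> h \<cdot> f"
    and cmp_hplus_right: "\<lbrakk>f \<in> homset T A B; g \<in> homset T A B; h \<in> homset T B C\<rbrakk>
        \<Longrightarrow> h \<cdot> (f \<boxplus> g) = h \<cdot> f \<boxplus> h \<cdot> g"
    and ex_zero_object: "\<exists>Z. is_zero_object T Z"
    and ex_biproduct: "\<lbrakk>A \<in> obj T; B \<in> obj T\<rbrakk> \<Longrightarrow>
        \<exists>P\<in>obj T. \<exists>i\<in>homset T A P. \<exists>j\<in>homset T B P. \<exists>p\<in>homset T P A. \<exists>q\<in>homset T P B.
          p \<cdot> i = ident T A \<and> q \<cdot> j = ident T B \<and> q \<cdot> i = hzero T A B \<and> p \<cdot> j = hzero T B A \<and>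
          i \<cdot> p \<boxplus> j \<cdot> q = ident T P"

text \<open>
  The shift \<open>\<Sigma>\<close> is only required to be an additive auto-equivalence (this includes the convention
  in which it is an automorphism).
\<close>

locale triangulated_category = additive_category T
  for T :: "('o, 'm, 'z) pretriangulation_scheme" (structure) +
  assumes shift_obj_closed: "A \<in> obj T \<Longrightarrow> shift_obj T A \<in> obj T"
    and shift_hom: "f \<in> homset T A B \<Longrightarrow> shift T f \<in> homset T (shift_obj T A) (shift_obj T B)"
    and shift_ident: "A \<in> obj T \<Longrightarrow> shift T (ident T A) = ident T (shift_obj T A)"
    and shift_cmp: "\<lbrakk>f \<in> homset T A B; g \<in> homset T B C\<rbrakk>
        \<Longrightarrow> shift T (g \<cdot> f) = shift T g \<cdot> shift T f"
    and shift_hplus: "\<lbrakk>f \<in> homset T A B; g \<in> homset T A B\<rbrakk>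
        \<Longrightarrow> shift T (f \<boxplus> g) = shift T f \<boxplus> shift T g"
    and shift_fully_faithful: "\<lbrakk>A \<in> obj T; B \<in> obj T\<rbrakk>
        \<Longrightarrow> bij_betw (shift T) (homset T A B) (homset T (shift_obj T A) (shift_obj T B))"
    and shift_ess_surj: "B \<in> obj T \<Longrightarrow> \<exists>A\<in>obj T. isomorphic T (shift_obj T A) B"
    and triangle_arrows: "(u, v, w) \<in> triangles T \<Longrightarrow>
        \<exists>X Y Z. u \<in> homset T X Y \<and> v \<in> homset T Y Z \<and> w \<in> homset T Z (shift_obj T X)"
    and TR1_iso: "\<lbrakk>(u, v, w) \<in> triangles T;
          u \<in> homset T X Y; v \<in> homset T Y Z; w \<in> homset T Z (shift_obj T X);
          u' \<in> homset T X' Y'; v' \<in> homset T Y' Z'; w' \<in> homset T Z' (shift_obj T X');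
          is_isomorphism T X X' a; is_isomorphism T Y Y' b; is_isomorphism T Z Z' c;
          b \<cdot> u = u' \<cdot> a; c \<cdot> v = v' \<cdot> b; shift T a \<cdot> w = w' \<cdot> c\<rbrakk>
        \<Longrightarrow> (u', v', w') \<in> triangles T"
    and TR1_ident: "\<lbrakk>X \<in> obj T; is_zero_object T Z\<rbrakk>
        \<Longrightarrow> (ident T X, hzero T X Z, hzero T Z (shift_obj T X)) \<in> triangles T"
    and TR1_cone: "u \<in> arr T \<Longrightarrow> \<exists>v w. (u, v, w) \<in> triangles T"
    and TR2: "\<lbrakk>u \<in> homset T X Y; v \<in> homset T Y Z; w \<in> homset T Z (shift_obj T X)\<rbrakk>
        \<Longrightarrow> (u, v, w) \<in> triangles T \<longleftrightarrow> (v, w, hneg T (shift T u)) \<in> triangles T"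
    and TR3: "\<lbrakk>(u, v, w) \<in> triangles T; (u', v', w') \<in> triangles T;
          a \<in> homset T (src T u) (src T u'); b \<in> homset T (tgt T u) (tgt T u');
          b \<cdot> u = u' \<cdot> a\<rbrakk>
        \<Longrightarrow> \<exists>c\<in>homset T (tgt T v) (tgt T v'). c \<cdot> v = v' \<cdot> b \<and> shift T a \<cdot> w = w' \<cdot> c"
    and TR4: "\<lbrakk>u \<in> homset T X Y; v \<in> homset T Y Z;
          (u, i, i') \<in> triangles T; (v, j, j') \<in> triangles T; (v \<cdot> u, k, k') \<in> triangles T\<rbrakk>
        \<Longrightarrow> \<exists>f\<in>homset T (tgt T i) (tgt T k). \<exists>g\<in>homset T (tgt T k) (tgt T j).
              (f, g, shift T i \<cdot> j') \<in> triangles T \<and>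
              f \<cdot> i = k \<cdot> v \<and> k' \<cdot> f = i' \<and> g \<cdot> k = j \<and> j' \<cdot> g = shift T u \<cdot> k'"


section \<open>Compact generation\<close>

text \<open>
  Size: a set is small if its cardinality is strictly less than that of \<open>U\<close>. The set-theoretic
  reading relative to a Grothendieck universe is the case where \<open>U\<close> has inaccessible cardinality;
  nothing is assumed about \<open>U\<close> here. Only the cardinality of \<open>U\<close> matters, and every small set is
  equipollent to a subset of \<open>U\<close>, so indexing families by small sets of elements of the type of
  \<open>U\<close> is no restriction.
\<close>

definition has_small_coproducts :: "('o, 'm, 'z) precategory_scheme \<Rightarrow> 'u set \<Rightarrow> bool" where
  "has_small_coproducts T U \<longleftrightarrow>
     (\<forall>(I :: 'u set) X. I \<prec> U \<longrightarrow> (\<forall>i\<in>I. X i \<in> obj T) \<longrightarrow> (\<exists>P \<iota>. is_coproduct T I X P \<iota>))"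

text \<open>
  \<open>sum_group\<close> is the direct sum of groups and \<open>gfinprod\<close> the (here additively read) sum of a
  finitely supported family, so the map below is the canonical comparison map from the direct sum
  of the groups \<open>Hom(A, X i)\<close> to \<open>Hom(A, P)\<close>, where \<open>P\<close> is a coproduct of the \<open>X i\<close>.
\<close>

definition compact_object :: "('o, 'm, 'z) preadditive_precategory_scheme \<Rightarrow> 'u set \<Rightarrow> 'o \<Rightarrow> bool" where
  "compact_object T U A \<longleftrightarrow> A \<in> obj T \<and>
     (\<forall>(I :: 'u set) X P \<iota>. I \<prec> U \<longrightarrow> (\<forall>i\<in>I. X i \<in> obj T) \<longrightarrow> is_coproduct T I X P \<iota> \<longrightarrow>
        (\<lambda>a. gfinprod (hom_group T A P) (\<lambda>i. cmp T (\<iota> i) (a i)) I)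
          \<in> iso (sum_group I (\<lambda>i. hom_group T A (X i))) (hom_group T A P))"

text \<open>\<open>S\<close> is the set of objects of a small version of the full subcategory of compact objects,
  that is, of a small full subcategory of it whose inclusion is an equivalence.\<close>

definition small_version_of_compacts ::
  "('o, 'm, 'z) preadditive_precategory_scheme \<Rightarrow> 'u set \<Rightarrow> 'o set \<Rightarrow> bool" where
  "small_version_of_compacts T U S \<longleftrightarrow>
     S \<prec> U \<and> (\<forall>A\<in>S. compact_object T U A) \<and> (\<forall>A. compact_object T U A \<longrightarrow> (\<exists>B\<in>S. isomorphic T A B))"

locale compactly_generated_triangulated_category = triangulated_category T
  for T :: "('o, 'm, 'z) pretriangulation_scheme" (structure) and U :: "'u set" +
  assumes small_coproducts: "has_small_coproducts T U"
    and compacts_essentially_small: "\<exists>S. small_version_of_compacts T U S"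
    and compacts_generate: "\<lbrakk>X \<in> obj T; \<And>A. compact_object T U A \<Longrightarrow> homset T A X = {hzero T A X}\<rbrakk>
        \<Longrightarrow> is_zero_object T X"


section \<open>pp formulas\<close>

text \<open>
  A variable \<open>(A, n)\<close> is the \<open>n\<close>-th variable of sort \<open>A\<close>. The term \<open>App f t\<close> is the function
  symbol of \<open>f : A \<rightarrow> B\<close> applied to a term \<open>t\<close> of sort \<open>B\<close>; it has sort \<open>A\<close>. Linear equations are
  the equations between terms of the same sort, and \<open>PP ys es\<close> is the system \<open>es\<close> with the
  variables \<open>ys\<close> existentially quantified.
\<close>

type_synonym 'o pp_var = "'o \<times> nat"

datatype ('o, 'm) pp_term =
    Var "'o pp_var"
  | Zero 'o
  | Plus "('o, 'm) pp_term" "('o, 'm) pp_term"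
  | App 'm "('o, 'm) pp_term"

datatype ('o, 'm) pp_formula = PP "'o pp_var list" "(('o, 'm) pp_term \<times> ('o, 'm) pp_term) list"

primrec term_vars :: "('o, 'm) pp_term \<Rightarrow> 'o pp_var set" where
  "term_vars (Var x) = {x}"
| "term_vars (Zero A) = {}"
| "term_vars (Plus s t) = term_vars s \<union> term_vars t"
| "term_vars (App f t) = term_vars t"

primrec term_sort :: "('o, 'm, 'z) precategory_scheme \<Rightarrow> ('o, 'm) pp_term \<Rightarrow> 'o" where
  "term_sort T (Var x) = fst x"
| "term_sort T (Zero A) = A"
| "term_sort T (Plus s t) = term_sort T s"
| "term_sort T (App f t) = src T f"

primrec wf_term ::
  "('o, 'm, 'z) precategory_scheme \<Rightarrow> 'o set \<Rightarrow> ('o, 'm) pp_term \<Rightarrow> bool" where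
  "wf_term T S (Var x) \<longleftrightarrow> fst x \<in> S"
| "wf_term T S (Zero A) \<longleftrightarrow> A \<in> S"
| "wf_term T S (Plus s t) \<longleftrightarrow> wf_term T S s \<and> wf_term T S t \<and> term_sort T s = term_sort T t"
| "wf_term T S (App f t) \<longleftrightarrow> wf_term T S t \<and> src T f \<in> S \<and> f \<in> homset T (src T f) (term_sort T t)"

text \<open>\<open>pp_formula_in T S x \<phi>\<close>: \<open>\<phi>\<close> is a pp formula in the free variable \<open>x\<close> (which, as usual, need
  not actually occur), with sorts in \<open>S\<close>.\<close>

fun pp_formula_in ::
  "('o, 'm, 'z) precategory_scheme \<Rightarrow> 'o set \<Rightarrow> 'o pp_var \<Rightarrow> ('o, 'm) pp_formula \<Rightarrow> bool" where
  "pp_formula_in T S x (PP ys es) \<longleftrightarrow>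
     fst x \<in> S \<and> x \<notin> set ys \<and> (\<forall>y\<in>set ys. fst y \<in> S) \<and>
     (\<forall>(s, t)\<in>set es. wf_term T S s \<and> wf_term T S t \<and> term_sort T s = term_sort T t \<and>
        term_vars s \<union> term_vars t \<subseteq> insert x (set ys))"

primrec eval_term ::
  "('o, 'm, 'z) preadditive_precategory_scheme \<Rightarrow> 'o \<Rightarrow> ('o pp_var \<Rightarrow> 'm) \<Rightarrow> ('o, 'm) pp_term \<Rightarrow> 'm"
where
  "eval_term T X v (Var x) = v x"
| "eval_term T X v (Zero A) = hzero T A X"
| "eval_term T X v (Plus s t) = hplus T (eval_term T X v s) (eval_term T X v t)"
| "eval_term T X v (App f t) = cmp T (eval_term T X v t) f"

definition valuation ::
  "('o, 'm, 'z) precategory_scheme \<Rightarrow> 'o set \<Rightarrow> 'o \<Rightarrow> ('o pp_var \<Rightarrow> 'm) \<Rightarrow> bool" where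
  "valuation T S X v \<longleftrightarrow> (\<forall>x. fst x \<in> S \<longrightarrow> v x \<in> homset T (fst x) X)"

fun satisfies ::
  "('o, 'm, 'z) preadditive_precategory_scheme \<Rightarrow> 'o set \<Rightarrow> 'o \<Rightarrow> ('o pp_var \<Rightarrow> 'm) \<Rightarrow>
   ('o, 'm) pp_formula \<Rightarrow> bool" where
  "satisfies T S X v (PP ys es) \<longleftrightarrow>
     (\<exists>w. valuation T S X w \<and> (\<forall>x. x \<notin> set ys \<longrightarrow> w x = v x) \<and>
          (\<forall>(s, t)\<in>set es. eval_term T X w s = eval_term T X w t))"

definition solutions ::
  "('o, 'm, 'z) preadditive_precategory_scheme \<Rightarrow> 'o set \<Rightarrow> 'o pp_var \<Rightarrow> ('o, 'm) pp_formula \<Rightarrow>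
   'o \<Rightarrow> 'm set" where
  "solutions T S x \<phi> X =
     {a \<in> homset T (fst x) X. \<exists>v. valuation T S X v \<and> v x = a \<and> satisfies T S X v \<phi>}"

text \<open>The formula \<open>f | x\<close>; the index of the bound variable makes it different from \<open>x\<close> also when
  \<open>f\<close> is an endomorphism.\<close>

definition divides_formula ::
  "('o, 'm, 'z) precategory_scheme \<Rightarrow> 'm \<Rightarrow> 'o pp_var \<Rightarrow> ('o, 'm) pp_formula" where
  "divides_formula T f x =
     (let y = (tgt T f, Suc (snd x)) in PP [y] [(Var x, App f (Var y))])"

definition pp_equivalent ::
  "('o, 'm, 'z) preadditive_precategory_scheme \<Rightarrow> 'o set \<Rightarrow> 'o pp_var \<Rightarrow>
   ('o, 'm) pp_formula \<Rightarrow> ('o, 'm) pp_formula \<Rightarrow> bool" where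
  "pp_equivalent T S x \<phi> \<psi> \<longleftrightarrow> (\<forall>X\<in>obj T. solutions T S x \<phi> X = solutions T S x \<psi> X)"

definition pp_le ::
  "('o, 'm, 'z) preadditive_precategory_scheme \<Rightarrow> 'o set \<Rightarrow> 'o pp_var \<Rightarrow>
   ('o, 'm) pp_formula \<Rightarrow> ('o, 'm) pp_formula \<Rightarrow> bool" where
  "pp_le T S x \<phi> \<psi> \<longleftrightarrow> (\<forall>X\<in>obj T. solutions T S x \<phi> X \<subseteq> solutions T S x \<psi> X)"

definition pp_type ::
  "('o, 'm, 'z) preadditive_precategory_scheme \<Rightarrow> 'o set \<Rightarrow> 'o pp_var \<Rightarrow> 'o \<Rightarrow> 'm \<Rightarrow>
   ('o, 'm) pp_formula set" where
  "pp_type T S x X a = {\<psi>. pp_formula_in T S x \<psi> \<and> a \<in> solutions T S x \<psi> X}"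

definition pp_filter ::
  "('o, 'm, 'z) preadditive_precategory_scheme \<Rightarrow> 'o set \<Rightarrow> 'o pp_var \<Rightarrow> ('o, 'm) pp_formula \<Rightarrow>
   ('o, 'm) pp_formula set" where
  "pp_filter T S x \<phi> = {\<psi>. pp_formula_in T S x \<psi> \<and> pp_le T S x \<phi> \<psi>}"

definition free_realisation ::
  "('o, 'm, 'z) preadditive_precategory_scheme \<Rightarrow> 'u set \<Rightarrow> 'o set \<Rightarrow> 'o pp_var \<Rightarrow>
   ('o, 'm) pp_formula \<Rightarrow> 'o \<Rightarrow> 'm \<Rightarrow> bool" where
  "free_realisation T U S x \<phi> C c \<longleftrightarrow>
     compact_object T U C \<and> c \<in> homset T (fst x) C \<and> pp_type T S x C c = pp_filter T S x \<phi>"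

end

theory Submission
  imports Defs
begin

text \<open>
  A valuation of finitely many variables in \<open>X\<close> is a morphism into \<open>X\<close> from the biproduct of the sorts,
  and a linear equation says that this morphism kills a given morphism between compact objects, that is,
  that it factors through the cone. Iterating, a system of equations has a weakly universal solution
  in a compact object, and the component \<open>f\<close> of that solution at the free variable satisfies
  \<open>\<phi>(X) = {g \<cdot> f | g}\<close> for all \<open>X\<close>. Since pp formulas are preserved by morphisms, \<open>f\<close> belongs to \<open>\<psi>(B)\<close>
  iff \<open>{g \<cdot> f | g} \<subseteq> \<psi>(X)\<close> for all \<open>X\<close>, which makes \<open>(B, f)\<close> a free realisation. What remains
  is that compact objects are closed under biproducts and cones.
\<close>

section \<open>Additive categories\<close>

context category
begin

lemma homset_obj:
  assumes "f \<in> homset T A B"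
  shows "A \<in> obj T" and "B \<in> obj T"
  using assms src_obj tgt_obj unfolding homset_def by auto

lemma coproduct_hom_eqI:
  assumes "is_coproduct T I X P \<iota>"
    and "h \<in> homset T P Y" and "h' \<in> homset T P Y"
    and "\<And>i. i \<in> I \<Longrightarrow> h \<cdot> \<iota> i = h' \<cdot> \<iota> i"
  shows "h = h'"
proof -
  have "\<forall>i\<in>I. h \<cdot> \<iota> i \<in> homset T (X i) Y"
    using assms(1,2) cmp_hom unfolding is_coproduct_def by blast
  with assms(1) have "\<exists>!k. k \<in> homset T P Y \<and> (\<forall>i\<in>I. k \<cdot> \<iota> i = h \<cdot> \<iota> i)"
    using homset_obj(2)[OF assms(2)] unfolding is_coproduct_def by simp
  with assms(2,3,4) show ?thesis
    by metis
qed

lemma coproduct_hom_ex: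
  assumes "is_coproduct T I X P \<iota>" and "Y \<in> obj T"
    and "\<And>i. i \<in> I \<Longrightarrow> g i \<in> homset T (X i) Y"
  shows "\<exists>h\<in>homset T P Y. \<forall>i\<in>I. h \<cdot> \<iota> i = g i"
  using assms unfolding is_coproduct_def by blast

end

context additive_category
begin

lemma hplus_hom:
  assumes "f \<in> homset T A B" and "g \<in> homset T A B"
  shows "f \<boxplus> g \<in> homset T A B"
proof -
  interpret comm_group "hom_group T A B"
    by (rule hom_comm_group) (use homset_obj[OF assms(1)] in auto)
  show ?thesis
    using m_closed assms by (simp add: hom_group_def)
qed

lemma hzero_hom:
  assumes "A \<in> obj T" and "B \<in> obj T"
  shows "hzero T A B \<in> homset T A B"
proof -
  interpret comm_group "hom_group T A B"
    by (rule hom_comm_group) (use assms in auto)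
  show ?thesis
    using one_closed by (simp add: hom_group_def)
qed

lemma hplus_hzero:
  assumes "f \<in> homset T A B"
  shows "f \<boxplus> hzero T A B = f" and "hzero T A B \<boxplus> f = f"
proof -
  interpret comm_group "hom_group T A B"
    by (rule hom_comm_group) (use homset_obj[OF assms(1)] in auto)
  show "f \<boxplus> hzero T A B = f" and "hzero T A B \<boxplus> f = f"
    using l_one r_one assms by (simp_all add: hom_group_def)
qed

lemma hplus_eq_self:
  assumes "f \<in> homset T A B" and "g \<in> homset T A B" and "f \<boxplus> g = f"
  shows "g = hzero T A B"
proof -
  interpret comm_group "hom_group T A B"
    by (rule hom_comm_group) (use homset_obj[OF assms(1)] in auto)
  show ?thesis
    using l_cancel_one assms by (simp add: hom_group_def)
qed

lemma hplus_right_cancel: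
  assumes "f \<in> homset T A B" and "g \<in> homset T A B" and "h \<in> homset T A B"
  shows "f \<boxplus> h = g \<boxplus> h \<longleftrightarrow> f = g"
proof -
  interpret comm_group "hom_group T A B"
    by (rule hom_comm_group) (use homset_obj[OF assms(1)] in auto)
  show ?thesis
    using right_cancel assms by (simp add: hom_group_def)
qed

text \<open>Here \<open>k\<close> is f - g in the abelian group Hom(A, B). The existential form
  spares later arguments any mention of inverses.\<close>

lemma hplus_ex_difference:
  assumes "f \<in> homset T A B" and "g \<in> homset T A B"
  shows "\<exists>k\<in>homset T A B. f = k \<boxplus> g"
proof -
  interpret comm_group "hom_group T A B"
    by (rule hom_comm_group) (use homset_obj[OF assms(1)] in auto)
  have c: "f \<in> carrier (hom_group T A B)" "g \<in> carrier (hom_group T A B)"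
    using assms by (simp_all add: hom_group_def)
  let ?k = "f \<otimes>\<^bsub>hom_group T A B\<^esub> inv\<^bsub>hom_group T A B\<^esub> g"
  have "?k \<in> carrier (hom_group T A B)" and "f = ?k \<otimes>\<^bsub>hom_group T A B\<^esub> g"
    using c by (simp_all add: m_assoc)
  then show ?thesis
    unfolding hom_group_def by auto
qed

section \<open>Zero morphisms, equalising differences and zero objects\<close>

lemma cmp_hzero_right:
  assumes "h \<in> homset T B C" and "A \<in> obj T"
  shows "h \<cdot> hzero T A B = hzero T A C"
proof -
  have z: "hzero T A B \<in> homset T A B"
    using assms homset_obj hzero_hom by blast
  have "h \<cdot> hzero T A B \<boxplus> h \<cdot> hzero T A B = h \<cdot> hzero T A B"
    using cmp_hplus_right[OF z z assms(1)] hplus_hzero[OF z] by simp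
  then show ?thesis
    using hplus_eq_self cmp_hom[OF z assms(1)] by blast
qed

lemma cmp_hzero_left:
  assumes "f \<in> homset T A B" and "C \<in> obj T"
  shows "hzero T B C \<cdot> f = hzero T A C"
proof -
  have z: "hzero T B C \<in> homset T B C"
    using assms homset_obj hzero_hom by blast
  have "hzero T B C \<cdot> f \<boxplus> hzero T B C \<cdot> f = hzero T B C \<cdot> f"
    using cmp_hplus_left[OF assms(1) z z] hplus_hzero[OF z] by simp
  then show ?thesis
    using hplus_eq_self cmp_hom[OF assms(1) z] by blast
qed

text \<open>Take d = s - t. One \<open>d\<close> serves all targets X at once, so its cone can later
  impose the equation s = t.\<close>

lemma ex_equalising_difference:
  assumes "s \<in> homset T C Y" and "t \<in> homset T C Y"
  shows "\<exists>d\<in>homset T C Y. \<forall>X. \<forall>h\<in>homset T Y X. h \<cdot> d = hzero T C X \<longleftrightarrow> h \<cdot> s = h \<cdot> t"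
proof -
  obtain d where d: "d \<in> homset T C Y" "s = d \<boxplus> t"
    using hplus_ex_difference[OF assms] by blast
  have "h \<cdot> d = hzero T C X \<longleftrightarrow> h \<cdot> s = h \<cdot> t" if h: "h \<in> homset T Y X" for X h
  proof -
    have hom: "h \<cdot> d \<in> homset T C X" "h \<cdot> t \<in> homset T C X" "hzero T C X \<in> homset T C X"
      using assms d h cmp_hom homset_obj hzero_hom by blast+
    have "h \<cdot> s = h \<cdot> d \<boxplus> h \<cdot> t"
      using cmp_hplus_right[OF d(1) assms(2) h] d(2) by simp
    moreover have "h \<cdot> t = hzero T C X \<boxplus> h \<cdot> t"
      using hplus_hzero hom by simp
    ultimately show ?thesis
      using hplus_right_cancel[OF hom(1,3,2)] by simp
  qed
  with d(1) show ?thesis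
    by blast
qed

text \<open>An equation between morphisms is preserved by an additive functor; this will show that
  the shift of a zero object is zero.\<close>

lemma is_zero_object_iff_ident:
  assumes "Z \<in> obj T"
  shows "is_zero_object T Z \<longleftrightarrow> ident T Z = hzero T Z Z"
proof
  assume "is_zero_object T Z"
  then show "ident T Z = hzero T Z Z"
    using ident_hom[OF assms] hzero_hom[OF assms assms] assms unfolding is_zero_object_def by blast
next
  assume eq: "ident T Z = hzero T Z Z"
  have "f = hzero T Z X" if "f \<in> homset T Z X" for f X
    using cmp_ident_right[OF that] eq cmp_hzero_right[OF that assms] by simp
  moreover have "f = hzero T X Z" if "f \<in> homset T X Z" for f X
    using cmp_ident_left[OF that] eq cmp_hzero_left[OF that assms] by simp
  ultimately show "is_zero_object T Z"
    using assms hzero_hom unfolding is_zero_object_def by blast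
qed

end

section \<open>Finitely supported morphisms into a coproduct\<close>

text \<open>For a coproduct P this is the image in Hom(A, P) of the direct sum of the groups Hom(A,
  X i). It is closed under negation as well, since -(\<iota> i \<cdot> a) = \<iota> i \<cdot> (-a).
  Generating it inductively replaces sums over finite index sets by rule induction.\<close>

inductive_set finite_sums ::
    "('o, 'm, 'z) preadditive_precategory_scheme \<Rightarrow> 'i set \<Rightarrow> ('i \<Rightarrow> 'o) \<Rightarrow> 'o \<Rightarrow> ('i \<Rightarrow> 'm) \<Rightarrow>
      'o \<Rightarrow> 'm set"
  for T I X P \<iota> A
  where
    zero: "hzero T A P \<in> finite_sums T I X P \<iota> A"
  | single: "i \<in> I \<Longrightarrow> a \<in> homset T A (X i) \<Longrightarrow> cmp T (\<iota> i) a \<in> finite_sums T I X P \<iota> A"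
  | plus: "f \<in> finite_sums T I X P \<iota> A \<Longrightarrow> g \<in> finite_sums T I X P \<iota> A \<Longrightarrow>
      hplus T f g \<in> finite_sums T I X P \<iota> A"

context additive_category
begin

lemma finite_sums_hom:
  assumes "f \<in> finite_sums T I X P \<iota> A" and "is_coproduct T I X P \<iota>" and "A \<in> obj T"
  shows "f \<in> homset T A P"
  using assms(1)
proof induction
  case zero
  then show ?case
    using assms hzero_hom unfolding is_coproduct_def by blast
next
  case (single i a)
  then show ?case
    using assms cmp_hom unfolding is_coproduct_def by blast
next
  case (plus f g)
  then show ?case
    using hplus_hom by blast
qed

text \<open>Finite sums form a subfunctor of Hom(-, P), because precomposition distributes over the
  generators. The closure properties of compact objects factor a morphism and then appeal to
  this.\<close>

lemma finite_sums_cmp: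
  assumes "f \<in> finite_sums T I X P \<iota> A" and P: "is_coproduct T I X P \<iota>" and g: "g \<in> homset T B A"
  shows "f \<cdot> g \<in> finite_sums T I X P \<iota> B"
  using assms(1)
proof induction
  case zero
  have "hzero T A P \<cdot> g = hzero T B P"
    using cmp_hzero_left[OF g] P unfolding is_coproduct_def by blast
  then show ?case
    using finite_sums.zero by metis
next
  case (single i a)
  have "\<iota> i \<cdot> a \<cdot> g = \<iota> i \<cdot> (a \<cdot> g)"
    using cmp_assoc[OF g single(2)] single(1) P unfolding is_coproduct_def by metis
  then show ?case
    using finite_sums.single[where X = X, OF single(1) cmp_hom[OF g single(2)]] by metis
next
  case (plus f f')
  have A: "A \<in> obj T"
    using g homset_obj by blast
  have "(f \<boxplus> f') \<cdot> g = f \<cdot> g \<boxplus> f' \<cdot> g"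
    using cmp_hplus_left[OF g] finite_sums_hom[OF _ P A] plus by blast
  then show ?case
    using finite_sums.plus plus.IH by metis
qed

lemma ex_coproduct_projection:
  assumes P: "is_coproduct T I X P \<iota>" and X: "\<And>i. i \<in> I \<Longrightarrow> X i \<in> obj T" and "j \<in> I"
  shows "\<exists>p\<in>homset T P (X j). p \<cdot> \<iota> j = ident T (X j) \<and> (\<forall>i\<in>I - {j}. p \<cdot> \<iota> i = hzero T (X i) (X j))"
proof -
  \<comment> \<open>The Kronecker delta family, which the universal property turns into the
    projection.\<close>
  let ?g = "\<lambda>i. if i = j then ident T (X j) else hzero T (X i) (X j)"
  have "?g i \<in> homset T (X i) (X j)" if "i \<in> I" for i
    using that assms ident_hom hzero_hom by auto
  from coproduct_hom_ex[OF P X[OF \<open>j \<in> I\<close>] this]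
  obtain p where "p \<in> homset T P (X j)" "\<And>i. i \<in> I \<Longrightarrow> p \<cdot> \<iota> i = ?g i"
    by blast
  with \<open>j \<in> I\<close> show ?thesis
    by (intro bexI[of _ p]) auto
qed

text \<open>The projector onto the part of P indexed by F is the sum of the \<iota> j \<cdot> p j
  for j in F, built up one index at a time. As e is itself a finite sum, so is every e \<cdot>
  h.\<close>

lemma ex_finite_sum_projector:
  assumes P: "is_coproduct T I X P \<iota>" and X: "\<And>i. i \<in> I \<Longrightarrow> X i \<in> obj T"
    and "finite F" and "F \<subseteq> I"
  shows "\<exists>e\<in>finite_sums T I X P \<iota> P. (\<forall>i\<in>F. e \<cdot> \<iota> i = \<iota> i) \<and> (\<forall>i\<in>I - F. e \<cdot> \<iota> i = hzero T (X i) P)"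
  using assms(3,4)
proof (induction F)
  case empty
  have "P \<in> obj T"
    using P unfolding is_coproduct_def by blast
  then have "hzero T P P \<cdot> \<iota> i = hzero T (X i) P" if "i \<in> I" for i
    using P that cmp_hzero_left unfolding is_coproduct_def by blast
  then show ?case
    using finite_sums.zero by (metis DiffD1 empty_iff)
next
  case (insert j F)
  then obtain e where e: "e \<in> finite_sums T I X P \<iota> P" "\<And>i. i \<in> F \<Longrightarrow> e \<cdot> \<iota> i = \<iota> i"
      "\<And>i. i \<in> I - F \<Longrightarrow> e \<cdot> \<iota> i = hzero T (X i) P"
    by blast
  obtain p where p: "p \<in> homset T P (X j)" "p \<cdot> \<iota> j = ident T (X j)"
      "\<And>i. i \<in> I \<Longrightarrow> i \<noteq> j \<Longrightarrow> p \<cdot> \<iota> i = hzero T (X i) (X j)"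
    using ex_coproduct_projection[OF P X] insert.prems by blast
  have "P \<in> obj T" and \<iota>: "\<And>i. i \<in> I \<Longrightarrow> \<iota> i \<in> homset T (X i) P"
    using P unfolding is_coproduct_def by blast+
  have j: "j \<in> I"
    using insert.prems by blast
  have eh: "e \<in> homset T P P"
    using finite_sums_hom[OF e(1) P] \<open>P \<in> obj T\<close> by blast
  have jp: "\<iota> j \<cdot> p \<in> finite_sums T I X P \<iota> P" "\<iota> j \<cdot> p \<in> homset T P P"
    using finite_sums.single[where X = X, OF j p(1)] cmp_hom[OF p(1) \<iota>[OF j]] by blast+
  have sum: "(e \<boxplus> \<iota> j \<cdot> p) \<cdot> \<iota> i = e \<cdot> \<iota> i \<boxplus> \<iota> j \<cdot> (p \<cdot> \<iota> i)" if "i \<in> I" for i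
    using cmp_hplus_left[OF \<iota>[OF that] eh jp(2)] cmp_assoc[OF \<iota>[OF that] p(1) \<iota>[OF j]] by simp
  have "(e \<boxplus> \<iota> j \<cdot> p) \<cdot> \<iota> j = \<iota> j"
    using sum[OF j] p(2) e(3)[of j] j insert.hyps cmp_ident_right[OF \<iota>[OF j]] hplus_hzero[OF \<iota>[OF j]]
    by simp
  moreover have "(e \<boxplus> \<iota> j \<cdot> p) \<cdot> \<iota> i = e \<cdot> \<iota> i" if "i \<in> I" "i \<noteq> j" for i
    using sum[OF that(1)] p(3)[OF that] cmp_hzero_right[OF \<iota>[OF j] X[OF that(1)]]
      hplus_hzero[OF cmp_hom[OF \<iota>[OF that(1)] eh]] by simp
  ultimately have "(\<forall>i\<in>insert j F. (e \<boxplus> \<iota> j \<cdot> p) \<cdot> \<iota> i = \<iota> i) \<and>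
      (\<forall>i\<in>I - insert j F. (e \<boxplus> \<iota> j \<cdot> p) \<cdot> \<iota> i = hzero T (X i) P)"
    using e(2,3) insert.prems insert.hyps by (metis DiffD1 DiffD2 DiffI insert_iff subset_iff)
  then show ?case
    using finite_sums.plus[OF e(1) jp(1)] by blast
qed

text \<open>Finite support is tested by fixing f, so that no components of f have to be chosen. A
  generator is supported at its own index, and the supports of two summands are united.\<close>

lemma finite_sums_finite_support:
  assumes "f \<in> finite_sums T I X P \<iota> A" and P: "is_coproduct T I X P \<iota>" and A: "A \<in> obj T"
  shows "\<exists>F\<subseteq>I. finite F \<and> (\<forall>e\<in>homset T P P. (\<forall>i\<in>F. e \<cdot> \<iota> i = \<iota> i) \<longrightarrow> e \<cdot> f = f)"
  using assms(1)
proof induction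
  case zero
  show ?case
    using cmp_hzero_right A by blast
next
  case (single i a)
  have "\<iota> i \<in> homset T (X i) P"
    using single P unfolding is_coproduct_def by blast
  then have "e \<cdot> (\<iota> i \<cdot> a) = \<iota> i \<cdot> a" if "e \<in> homset T P P" "e \<cdot> \<iota> i = \<iota> i" for e
    using cmp_assoc[OF single(2)] that by metis
  then show ?case
    using single(1) by (intro exI[of _ "{i}"]) auto
next
  case (plus f g)
  obtain F where F: "F \<subseteq> I" "finite F"
      "\<And>e. e \<in> homset T P P \<Longrightarrow> (\<forall>i\<in>F. e \<cdot> \<iota> i = \<iota> i) \<Longrightarrow> e \<cdot> f = f"
    using plus.IH(1) by blast
  obtain G where G: "G \<subseteq> I" "finite G"
      "\<And>e. e \<in> homset T P P \<Longrightarrow> (\<forall>i\<in>G. e \<cdot> \<iota> i = \<iota> i) \<Longrightarrow> e \<cdot> g = g"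
    using plus.IH(2) by blast
  have "f \<in> homset T A P" "g \<in> homset T A P"
    using plus.hyps finite_sums_hom[OF _ P A] by blast+
  then have "e \<cdot> (f \<boxplus> g) = f \<boxplus> g" if "e \<in> homset T P P" "\<forall>i\<in>F \<union> G. e \<cdot> \<iota> i = \<iota> i" for e
    using cmp_hplus_right[of f A P g e P] F(3)[of e] G(3)[of e] that by simp
  then show ?case
    using F G by (intro exI[of _ "F \<union> G"]) auto
qed

text \<open>The projector onto a finite support of f fixes f.\<close>

lemma finite_sums_fixed:
  assumes "f \<in> finite_sums T I X P \<iota> A" and "is_coproduct T I X P \<iota>" and "A \<in> obj T"
    and "\<And>i. i \<in> I \<Longrightarrow> X i \<in> obj T"
  shows "\<exists>e\<in>finite_sums T I X P \<iota> P. e \<cdot> f = f"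
proof -
  obtain F where F: "F \<subseteq> I" "finite F"
      "\<And>e. e \<in> homset T P P \<Longrightarrow> (\<forall>i\<in>F. e \<cdot> \<iota> i = \<iota> i) \<Longrightarrow> e \<cdot> f = f"
    using finite_sums_finite_support[OF assms(1-3)] by blast
  obtain e where e: "e \<in> finite_sums T I X P \<iota> P" "\<forall>i\<in>F. e \<cdot> \<iota> i = \<iota> i"
    using ex_finite_sum_projector[OF assms(2,4) F(2,1)] by blast
  have "e \<in> homset T P P"
    using finite_sums_hom[OF e(1) assms(2)] assms(2) unfolding is_coproduct_def by blast
  then show ?thesis
    using e F(3) by blast
qed

text \<open>The comparison map is always an injective homomorphism, because the coproduct injections are
  split by projections; so compactness amounts to its surjectivity.\<close>

lemma coproduct_comparison:
  assumes P: "is_coproduct T I X P \<iota>" and X: "\<And>i. i \<in> I \<Longrightarrow> X i \<in> obj T" and A: "A \<in> obj T"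
  shows "(\<lambda>a. gfinprod (hom_group T A P) (\<lambda>i. \<iota> i \<cdot> a i) I)
          \<in> mon (sum_group I (\<lambda>i. hom_group T A (X i))) (hom_group T A P)" (is "?c \<in> mon ?D _")
    and "(\<lambda>a. gfinprod (hom_group T A P) (\<lambda>i. \<iota> i \<cdot> a i) I)
          ` carrier (sum_group I (\<lambda>i. hom_group T A (X i))) = finite_sums T I X P \<iota> A"
      (is "_ = ?S")
proof -
  have P': "P \<in> obj T" and \<iota>: "\<And>i. i \<in> I \<Longrightarrow> \<iota> i \<in> homset T (X i) P"
    using P unfolding is_coproduct_def by blast+
  interpret G: comm_group "hom_group T A P"
    by (rule hom_comm_group[OF A P'])
  have grp: "group (hom_group T A (X i))" if "i \<in> I" for i
    using hom_comm_group[OF A X[OF that]] comm_group.axioms(2) by blast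
  have Gs: "carrier (hom_group T A P) = homset T A P" "\<one>\<^bsub>hom_group T A P\<^esub> = hzero T A P"
      "\<And>f g. f \<otimes>\<^bsub>hom_group T A P\<^esub> g = f \<boxplus> g"
    by (simp_all add: hom_group_def)
  have D: "a \<in> carrier ?D \<longleftrightarrow> a \<in> (\<Pi>\<^sub>E i\<in>I. homset T A (X i)) \<and> finite {i \<in> I. a i \<noteq> hzero T A (X i)}"
    for a
    using grp by (simp add: carrier_sum_group) (simp add: hom_group_def)
  have \<iota>_hom: "(\<lambda>a. \<iota> i \<cdot> a) \<in> hom (hom_group T A (X i)) (hom_group T A P)" if "i \<in> I" for i
    using cmp_hom[OF _ \<iota>[OF that]] cmp_hplus_right[OF _ _ \<iota>[OF that]]
    by (intro homI) (auto simp: hom_group_def)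
  interpret c: group_hom ?D "hom_group T A P" ?c
    using G.hom_group_sum[OF \<iota>_hom grp] grp
    by (simp add: group_hom_def group_hom_axioms_def G.is_group)
  have "?c a \<in> ?S" if "a \<in> carrier ?D" for a
  proof -
    have a: "\<iota> i \<cdot> a i \<in> homset T A P" "a i \<in> homset T A (X i)" if "i \<in> I" for i
      using \<open>a \<in> carrier ?D\<close> that cmp_hom[OF _ \<iota>] unfolding D by blast+
    \<comment> \<open>\<open>gfinprod\<close> runs over the indices with nonzero term. They lie in
      the support of a because \<iota> i \<cdot> 0 = 0, so there are finitely many.\<close>
    let ?F = "{i \<in> I. \<iota> i \<cdot> a i \<noteq> hzero T A P}"
    have "?F \<subseteq> {i \<in> I. a i \<noteq> hzero T A (X i)}"
      using cmp_hzero_right[OF \<iota> A] by auto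
    then have "finite ?F"
      using that D finite_subset by blast
    have "finprod (hom_group T A P) (\<lambda>i. \<iota> i \<cdot> a i) F \<in> ?S" if "finite F" "F \<subseteq> I" for F
      using that
    proof (induction F)
      case empty
      show ?case
        using Gs(2) by (simp add: finite_sums.zero)
    next
      case (insert i F)
      have "finprod (hom_group T A P) (\<lambda>i. \<iota> i \<cdot> a i) (insert i F) =
          \<iota> i \<cdot> a i \<boxplus> finprod (hom_group T A P) (\<lambda>i. \<iota> i \<cdot> a i) F"
        using insert a by (subst G.finprod_insert) (auto simp: Gs)
      moreover have "\<iota> i \<cdot> a i \<in> ?S"
        using finite_sums.single[where T = T and a = "a i" and X = X and \<iota> = \<iota> and A = A and P = P] insert.prems a by simp
      ultimately show ?case
        using finite_sums.plus[of "\<iota> i \<cdot> a i"] insert by simp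
    qed
    from this[OF \<open>finite ?F\<close>] show ?thesis
      using \<open>finite ?F\<close> unfolding gfinprod_def Gs by auto
  qed
  moreover have "f \<in> ?c ` carrier ?D" if "f \<in> ?S" for f
    using that
  proof induction
    case zero
    then show ?case
      by (intro image_eqI[of _ _ "\<one>\<^bsub>?D\<^esub>"]) (simp_all only: c.hom_one Gs(2) c.G.one_closed)
  next
    case (single i b)
    \<comment> \<open>The element of the direct sum concentrated at i. The restriction to I makes it
      extensional, as the carrier demands.\<close>
    let ?a = "\<lambda>k\<in>I. if k = i then b else hzero T A (X k)"
    have "?a \<in> carrier ?D"
      unfolding D using single hzero_hom[OF A X] by (auto intro: finite_subset[of _ "{i}"])
    moreover have "?c ?a = \<iota> i \<cdot> b"
    proof -
      have b: "\<iota> i \<cdot> b \<in> homset T A P"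
        using cmp_hom single \<iota> by blast
      have "?c ?a = gfinprod (hom_group T A P) (\<lambda>k. \<iota> k \<cdot> ?a k) {i}"
        using single b \<iota> cmp_hzero_right[OF \<iota> A] hzero_hom[OF A P']
        by (intro G.gfinprod_mono_neutral_cong_right) (auto simp: Gs)
      also have "\<dots> = \<iota> i \<cdot> b"
        using single b by (subst G.gfinprod_eq_finprod) (auto simp: Gs G.finprod_insert hplus_hzero)
      finally show ?thesis .
    qed
    ultimately show ?case
      by (intro image_eqI[of _ _ ?a]) (simp_all only:)
  next
    case (plus f g)
    then obtain a b where "a \<in> carrier ?D" "f = ?c a" "b \<in> carrier ?D" "g = ?c b"
      by blast
    then show ?case
      by (intro image_eqI[of _ _ "a \<otimes>\<^bsub>?D\<^esub> b"]) (simp_all only: c.hom_mult c.G.m_closed Gs(3))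
  qed
  ultimately show "?c ` carrier ?D = ?S"
    by blast
  \<comment> \<open>Injectivity: the projection p to X j kills every term of the sum except the
    j-th, where it returns a j. So a vanishing sum has vanishing components.\<close>
  have "a j = hzero T A (X j)" if a: "a \<in> carrier ?D" and ca: "?c a = hzero T A P" and j: "j \<in> I" for a j
  proof -
    obtain p where p: "p \<in> homset T P (X j)" "p \<cdot> \<iota> j = ident T (X j)"
        "\<And>i. i \<in> I \<Longrightarrow> i \<noteq> j \<Longrightarrow> p \<cdot> \<iota> i = hzero T (X i) (X j)"
      using ex_coproduct_projection[OF P X j] by blast
    have ai: "\<iota> i \<cdot> a i \<in> homset T A P" "a i \<in> homset T A (X i)" if "i \<in> I" for i
      using a that cmp_hom[OF _ \<iota>] unfolding D by blast+
    have pz: "p \<cdot> (\<iota> i \<cdot> a i) = hzero T A (X j)" if "i \<in> I" "i \<noteq> j" for i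
      using cmp_assoc[OF ai(2) \<iota> p(1)] cmp_hzero_left[OF ai(2) X[OF j]] p(3) that by simp
    have zero: "p \<cdot> finprod (hom_group T A P) (\<lambda>i. \<iota> i \<cdot> a i) F = hzero T A (X j)"
      if "finite F" "F \<subseteq> I - {j}" for F
      using that
    proof (induction F)
      case empty
      show ?case
        using cmp_hzero_right[OF p(1) A] Gs(2) by simp
    next
      case (insert i F)
      have "finprod (hom_group T A P) (\<lambda>i. \<iota> i \<cdot> a i) F \<in> homset T A P"
        using G.finprod_closed[of "\<lambda>i. \<iota> i \<cdot> a i" F] insert.prems ai(1) by (auto simp: Gs)
      moreover have "finprod (hom_group T A P) (\<lambda>i. \<iota> i \<cdot> a i) (insert i F) =
          \<iota> i \<cdot> a i \<boxplus> finprod (hom_group T A P) (\<lambda>i. \<iota> i \<cdot> a i) F"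
        using insert ai(1) by (subst G.finprod_insert) (auto simp: Gs)
      moreover have "p \<cdot> (\<iota> i \<cdot> a i) = hzero T A (X j)"
        using pz insert.prems by simp
      ultimately show ?case
        using cmp_hplus_right[OF ai(1) _ p(1), of i] insert hplus_hzero[OF hzero_hom[OF A X[OF j]]] by simp
    qed
    let ?F = "{i \<in> I - {j}. \<iota> i \<cdot> a i \<noteq> hzero T A P}"
    have "?F \<subseteq> {i \<in> I. a i \<noteq> hzero T A (X i)}"
      using cmp_hzero_right[OF \<iota> A] by auto
    then have fin: "finite ?F"
      using a D finite_subset by blast
    \<comment> \<open>The sum without its j-th term. It is killed by p, by the statement just proved
      for finite index sets.\<close>
    let ?r = "gfinprod (hom_group T A P) (\<lambda>i. \<iota> i \<cdot> a i) (I - {j})"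
    have r: "?r \<in> homset T A P" "p \<cdot> ?r = hzero T A (X j)"
      using G.gfinprod_closed[of "\<lambda>i. \<iota> i \<cdot> a i" "I - {j}"] ai(1) zero[OF fin] fin
      unfolding gfinprod_def Gs by auto
    have "?c a = \<iota> j \<cdot> a j \<boxplus> ?r"
      using G.gfinprod_insert[of "I - {j}" "\<lambda>i. \<iota> i \<cdot> a i" j] fin ai(1) j by (auto simp: Gs insert_absorb)
    then have "p \<cdot> ?c a = p \<cdot> (\<iota> j \<cdot> a j)"
      using cmp_hplus_right[OF ai(1)[OF j] r(1) p(1)] r(2)
        hplus_hzero[OF cmp_hom[OF ai(1)[OF j] p(1)]] by simp
    also have "\<dots> = a j"
      using cmp_assoc[OF ai(2)[OF j] \<iota>[OF j] p(1)] p(2) cmp_ident_left[OF ai(2)[OF j]] by simp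
    finally show ?thesis
      using ca cmp_hzero_right[OF p(1) A] by simp
  qed
  then have "a = \<one>\<^bsub>?D\<^esub>" if "a \<in> carrier ?D" and "?c a = \<one>\<^bsub>hom_group T A P\<^esub>" for a
    using that D[of a] by (auto simp: hom_group_def PiE_def extensional_def fun_eq_iff)
  then show "?c \<in> mon ?D (hom_group T A P)"
    using c.inj_on_one_iff c.homh unfolding mon_def by blast
qed

text \<open>The comparison map is injective with image the finite sums, so only surjectivity is at
  stake. The closure properties below all use compactness in this form.\<close>

lemma compact_object_iff:
  "compact_object T (U :: 'u set) A \<longleftrightarrow> A \<in> obj T \<and>
     (\<forall>(I :: 'u set) X P \<iota>. I \<prec> U \<longrightarrow> (\<forall>i\<in>I. X i \<in> obj T) \<longrightarrow> is_coproduct T I X P \<iota> \<longrightarrow>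
        homset T A P \<subseteq> finite_sums T I X P \<iota> A)"
proof -
  have "(\<lambda>a. gfinprod (hom_group T A P) (\<lambda>i. \<iota> i \<cdot> a i) I)
          \<in> iso (sum_group I (\<lambda>i. hom_group T A (X i))) (hom_group T A P)
        \<longleftrightarrow> homset T A P \<subseteq> finite_sums T I X P \<iota> A"
    if P: "is_coproduct T I X P \<iota>" and X: "\<forall>i\<in>I. X i \<in> obj T" and A: "A \<in> obj T"
    for I :: "'u set" and X P \<iota>
  proof -
    have "finite_sums T I X P \<iota> A \<subseteq> homset T A P"
      using finite_sums_hom[OF _ P A] by blast
    moreover have "carrier (hom_group T A P) = homset T A P"
      by (simp add: hom_group_def)
    ultimately show ?thesis
      using coproduct_comparison[OF P _ A] X unfolding iso_iff_mon_epi epi_def mon_def by auto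
  qed
  then show ?thesis
    unfolding compact_object_def by (intro conj_cong refl all_cong1 imp_cong) auto
qed

text \<open>A morphism h out of P decomposes as (h \<cdot> i) \<cdot> p + (h \<cdot> j) \<cdot> q,
  where h \<cdot> i and h \<cdot> j are finite sums by compactness of A and B.\<close>

lemma compact_biproduct:
  assumes A: "compact_object T (U :: 'u set) A" and B: "compact_object T U B" and P: "P \<in> obj T"
    and p: "p \<in> homset T P A" and q: "q \<in> homset T P B"
    and i: "i \<in> homset T A P" and j: "j \<in> homset T B P"
    and sum: "i \<cdot> p \<boxplus> j \<cdot> q = ident T P"
  shows "compact_object T U P"
  unfolding compact_object_iff
proof (intro conjI P allI impI subsetI)
  fix I :: "'u set" and X Q \<iota> h
  assume *: "I \<prec> U" "\<forall>i\<in>I. X i \<in> obj T" and Q: "is_coproduct T I X Q \<iota>"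
    and h: "h \<in> homset T P Q"
  have "h \<cdot> i \<in> finite_sums T I X Q \<iota> A" "h \<cdot> j \<in> finite_sums T I X Q \<iota> B"
    using A B * Q cmp_hom[OF i h] cmp_hom[OF j h] unfolding compact_object_iff by blast+
  then have "h \<cdot> i \<cdot> p \<boxplus> h \<cdot> j \<cdot> q \<in> finite_sums T I X Q \<iota> P"
    by (intro finite_sums.plus finite_sums_cmp[OF _ Q p] finite_sums_cmp[OF _ Q q])
  moreover have "h \<cdot> i \<cdot> p \<boxplus> h \<cdot> j \<cdot> q = h \<cdot> (i \<cdot> p \<boxplus> j \<cdot> q)"
    using cmp_hplus_right[OF cmp_hom[OF p i] cmp_hom[OF q j] h] cmp_assoc[OF p i h] cmp_assoc[OF q j h]
    by simp
  ultimately show "h \<in> finite_sums T I X Q \<iota> P"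
    using sum cmp_ident_right[OF h] by simp
qed

end

section \<open>Compact objects of a triangulated category\<close>

context triangulated_category
begin

section \<open>The shift, zero morphisms and exactness of triangles\<close>

lemma shift_full:
  assumes "g \<in> homset T (shift_obj T A) (shift_obj T B)" and "A \<in> obj T" and "B \<in> obj T"
  shows "\<exists>f\<in>homset T A B. shift T f = g"
  using assms(1) bij_betw_imp_surj_on[OF shift_fully_faithful[OF assms(2,3)]] by (metis imageE)

lemma shift_faithful:
  assumes "f \<in> homset T A B" and "g \<in> homset T A B" and "shift T f = shift T g"
  shows "f = g"
  using assms shift_fully_faithful homset_obj unfolding bij_betw_def inj_on_def by blast

lemma shift_hzero:
  assumes "A \<in> obj T" and "B \<in> obj T"
  shows "shift T (hzero T A B) = hzero T (shift_obj T A) (shift_obj T B)"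
  using hzero_hom[OF assms] hplus_hzero(1)[OF hzero_hom[OF assms]] shift_hplus shift_hom hplus_eq_self
  by metis

lemma hneg_hzero:
  assumes "A \<in> obj T" and "B \<in> obj T"
  shows "hneg T (hzero T A B) = hzero T A B"
proof -
  interpret comm_group "hom_group T A B"
    by (rule hom_comm_group) (use assms in auto)
  have "src T (hzero T A B) = A" "tgt T (hzero T A B) = B"
    using hzero_hom[OF assms] unfolding homset_def by auto
  then show ?thesis
    using inv_one by (simp add: hneg_def hom_group_def)
qed

text \<open>TR3 extends the identity of A and u to a morphism from the trivial triangle on A to the
  given one. Its third component factors v \<cdot> u through a zero object.\<close>

lemma triangle_cmp_zero:
  assumes tri: "(u, v, w) \<in> triangles T" and u: "u \<in> homset T A B" and v: "v \<in> homset T B C"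
  shows "v \<cdot> u = hzero T A C"
proof -
  obtain Z where Z: "is_zero_object T Z"
    using ex_zero_object by blast
  have objs: "A \<in> obj T" "Z \<in> obj T"
    using homset_obj[OF u] Z unfolding is_zero_object_def by blast+
  note z = hzero_hom[OF objs]
  have st: "src T (ident T A) = A" "tgt T (ident T A) = A" "tgt T (hzero T A Z) = Z"
      "src T u = A" "tgt T u = B" "tgt T v = C"
    using u v z ident_hom[OF objs(1)] unfolding homset_def by auto
  have "\<exists>c\<in>homset T Z C. c \<cdot> hzero T A Z = v \<cdot> u"
    using TR3[OF TR1_ident[OF objs(1) Z] tri, of "ident T A" u] u ident_hom[OF objs(1)]
    unfolding st by blast
  then show ?thesis
    using cmp_hzero_right[OF _ objs(1)] by metis
qed

text \<open>Rotate the trivial triangle on W back by TR2. For this the shift of Z must again be a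
  zero object, and the sign introduced by the rotation must disappear on a zero morphism.\<close>

lemma triangle_zero_ident:
  assumes W: "W \<in> obj T"
  shows "\<exists>Z\<in>obj T. (hzero T Z W, ident T W, hzero T W (shift_obj T Z)) \<in> triangles T"
proof -
  obtain Z where Z: "is_zero_object T Z"
    using ex_zero_object by blast
  have Zo: "Z \<in> obj T"
    using Z unfolding is_zero_object_def by blast
  note sZ = shift_obj_closed[OF Zo]
  have "is_zero_object T (shift_obj T Z)"
    using Z is_zero_object_iff_ident[OF Zo] is_zero_object_iff_ident[OF sZ]
      shift_ident[OF Zo] shift_hzero[OF Zo Zo] by simp
  then have "(ident T W, hzero T W (shift_obj T Z), hzero T (shift_obj T Z) (shift_obj T W)) \<in> triangles T"
    by (rule TR1_ident[OF W])
  then have "(hzero T Z W, ident T W, hzero T W (shift_obj T Z)) \<in> triangles T"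
    using TR2[OF hzero_hom[OF Zo W] ident_hom[OF W] hzero_hom[OF W sZ]]
      shift_hzero[OF Zo W] hneg_hzero[OF sZ shift_obj_closed[OF W]] by simp
  then show ?thesis
    using Zo by blast
qed

text \<open>As h kills u, it forms with A \<rightarrow> 0 a commuting square from u to 0
  \<rightarrow> W. TR3 completes it to a morphism of triangles, whose third component is k.\<close>

lemma triangle_weak_cokernel:
  assumes tri: "(u, v, w) \<in> triangles T" and u: "u \<in> homset T A B" and v: "v \<in> homset T B C"
    and h: "h \<in> homset T B W" and hu: "h \<cdot> u = hzero T A W"
  shows "\<exists>k\<in>homset T C W. k \<cdot> v = h"
proof -
  note objs = homset_obj[OF u] homset_obj[OF h]
  obtain Z where Z: "Z \<in> obj T" "(hzero T Z W, ident T W, hzero T W (shift_obj T Z)) \<in> triangles T"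
    using triangle_zero_ident objs by blast
  have z: "hzero T Z W \<in> homset T Z W" "hzero T A Z \<in> homset T A Z"
    using hzero_hom objs Z(1) by blast+
  have st: "src T u = A" "tgt T u = B" "tgt T v = C" "src T (hzero T Z W) = Z" "tgt T (hzero T Z W) = W"
      "tgt T (ident T W) = W"
    using u v z(1) ident_hom[OF objs(4)] unfolding homset_def by auto
  have "h \<cdot> u = hzero T Z W \<cdot> hzero T A Z"
    using hu cmp_hzero_right[OF z(1) objs(1)] by simp
  then have "\<exists>k\<in>homset T C W. k \<cdot> v = ident T W \<cdot> h"
    using TR3[OF tri Z(2), of "hzero T A Z" h] h z(2) unfolding st by blast
  then show ?thesis
    using cmp_ident_left[OF h] by simp
qed

text \<open>Since the shift is only an equivalence, a coproduct in the category is the shift of a coproduct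
  only up to isomorphism.\<close>

lemma coproduct_desuspension:
  assumes P: "is_coproduct T I X P \<iota>" and X: "\<And>i. i \<in> I \<Longrightarrow> X i \<in> obj T"
  obtains Y Q \<kappa> a e where "is_coproduct T I Y Q \<kappa>" and "\<And>i. i \<in> I \<Longrightarrow> Y i \<in> obj T"
    and "\<And>i. i \<in> I \<Longrightarrow> a i \<in> homset T (shift_obj T (Y i)) (X i)"
    and "is_isomorphism T (shift_obj T Q) P e"
    and "\<And>i. i \<in> I \<Longrightarrow> e \<cdot> shift T (\<kappa> i) = \<iota> i \<cdot> a i"
proof -
  have P': "P \<in> obj T" and \<iota>: "\<And>i. i \<in> I \<Longrightarrow> \<iota> i \<in> homset T (X i) P"
    using P unfolding is_coproduct_def by blast+
  \<comment> \<open>Essential surjectivity desuspends P up to isomorphism, and below likewise each X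
    i.\<close>
  obtain Q e where Q: "Q \<in> obj T" and iso: "is_isomorphism T (shift_obj T Q) P e"
    using shift_ess_surj[OF P'] unfolding isomorphic_def by blast
  obtain e' where e: "e \<in> homset T (shift_obj T Q) P" and e': "e' \<in> homset T P (shift_obj T Q)"
    and e'e: "e' \<cdot> e = ident T (shift_obj T Q)" and ee': "e \<cdot> e' = ident T P"
    using iso unfolding is_isomorphism_def by blast
  have "\<exists>Y a b. Y \<in> obj T \<and> a \<in> homset T (shift_obj T Y) (X i) \<and> b \<in> homset T (X i) (shift_obj T Y) \<and>
      b \<cdot> a = ident T (shift_obj T Y) \<and> a \<cdot> b = ident T (X i)" if "i \<in> I" for i
    using shift_ess_surj[OF X[OF that]] unfolding isomorphic_def is_isomorphism_def by blast
  then obtain Y a b where Y: "\<And>i. i \<in> I \<Longrightarrow> Y i \<in> obj T"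
    and a: "\<And>i. i \<in> I \<Longrightarrow> a i \<in> homset T (shift_obj T (Y i)) (X i)"
    and b: "\<And>i. i \<in> I \<Longrightarrow> b i \<in> homset T (X i) (shift_obj T (Y i))"
    and ba: "\<And>i. i \<in> I \<Longrightarrow> b i \<cdot> a i = ident T (shift_obj T (Y i))"
    and ab: "\<And>i. i \<in> I \<Longrightarrow> a i \<cdot> b i = ident T (X i)"
    by metis
  \<comment> \<open>Transport \<iota> i along the two isomorphisms; fullness of the shift then gives
    its desuspension \<kappa> i.\<close>
  have "\<exists>k\<in>homset T (Y i) Q. shift T k = e' \<cdot> (\<iota> i \<cdot> a i)" if "i \<in> I" for i
    using shift_full[OF cmp_hom[OF cmp_hom[OF a \<iota>] e'] Y Q] that by blast
  then obtain \<kappa> where \<kappa>: "\<And>i. i \<in> I \<Longrightarrow> \<kappa> i \<in> homset T (Y i) Q"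
    and s\<kappa>: "\<And>i. i \<in> I \<Longrightarrow> shift T (\<kappa> i) = e' \<cdot> (\<iota> i \<cdot> a i)"
    by metis
  have e\<kappa>: "e \<cdot> shift T (\<kappa> i) = \<iota> i \<cdot> a i" if "i \<in> I" for i
    using s\<kappa>[OF that] cmp_assoc[OF cmp_hom[OF a[OF that] \<iota>[OF that]] e' e] ee'
      cmp_ident_left[OF cmp_hom[OF a[OF that] \<iota>[OF that]]] by simp
  have "\<exists>!k. k \<in> homset T Q W \<and> (\<forall>i\<in>I. k \<cdot> \<kappa> i = g i)"
    if W: "W \<in> obj T" and g: "\<forall>i\<in>I. g i \<in> homset T (Y i) W" for W g
  proof (intro ex_ex1I)
    have sg: "shift T (g i) \<in> homset T (shift_obj T (Y i)) (shift_obj T W)" if "i \<in> I" for i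
      using shift_hom g that by blast
    \<comment> \<open>Existence: shift the family g, transport it to the X i along b i, factor it
      through P, and desuspend.\<close>
    obtain h where h: "h \<in> homset T P (shift_obj T W)" "\<And>i. i \<in> I \<Longrightarrow> h \<cdot> \<iota> i = shift T (g i) \<cdot> b i"
      using coproduct_hom_ex[OF P shift_obj_closed[OF W], of "\<lambda>i. shift T (g i) \<cdot> b i"]
        cmp_hom[OF b sg] by blast
    obtain k where k: "k \<in> homset T Q W" "shift T k = h \<cdot> e"
      using shift_full[OF cmp_hom[OF e h(1)] Q W] by blast
    have "k \<cdot> \<kappa> i = g i" if i: "i \<in> I" for i
    proof (rule shift_faithful)
      show "k \<cdot> \<kappa> i \<in> homset T (Y i) W" "g i \<in> homset T (Y i) W"
        using cmp_hom[OF \<kappa> k(1)] g i by blast+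
      have "shift T (k \<cdot> \<kappa> i) = h \<cdot> e \<cdot> shift T (\<kappa> i)"
        using shift_cmp[OF \<kappa>[OF i] k(1)] k(2) by simp
      also have "\<dots> = h \<cdot> (\<iota> i \<cdot> a i)"
        using cmp_assoc[OF shift_hom[OF \<kappa>[OF i]] e h(1)] e\<kappa>[OF i] by simp
      also have "\<dots> = shift T (g i) \<cdot> (b i \<cdot> a i)"
        using cmp_assoc[OF a[OF i] \<iota>[OF i] h(1)] cmp_assoc[OF a[OF i] b[OF i] sg[OF i]] h(2)[OF i] by simp
      also have "\<dots> = shift T (g i)"
        using ba[OF i] cmp_ident_right[OF sg[OF i]] by simp
      finally show "shift T (k \<cdot> \<kappa> i) = shift T (g i)" .
    qed
    with k(1) show "\<exists>k. k \<in> homset T Q W \<and> (\<forall>i\<in>I. k \<cdot> \<kappa> i = g i)"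
      by blast
  next
    fix k l
    assume k: "k \<in> homset T Q W \<and> (\<forall>i\<in>I. k \<cdot> \<kappa> i = g i)" and l: "l \<in> homset T Q W \<and> (\<forall>i\<in>I. l \<cdot> \<kappa> i = g i)"
    \<comment> \<open>Uniqueness: the shift of a solution m, transported to P, has prescribed
      composites with all \<iota> i. So uniqueness for P applies, followed by faithfulness of the
      shift.\<close>
    have *: "shift T m \<cdot> e' \<cdot> \<iota> i = shift T (g i) \<cdot> b i"
      if m: "m \<in> homset T Q W" "\<forall>i\<in>I. m \<cdot> \<kappa> i = g i" and i: "i \<in> I" for m i
    proof -
      note sm = shift_hom[OF m(1)]
      have "\<iota> i = \<iota> i \<cdot> a i \<cdot> b i"
        using cmp_assoc[OF b[OF i] a[OF i] \<iota>[OF i]] ab[OF i] cmp_ident_right[OF \<iota>[OF i]] by simp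
      then have "shift T m \<cdot> e' \<cdot> \<iota> i = shift T m \<cdot> e' \<cdot> (\<iota> i \<cdot> a i \<cdot> b i)"
        by simp
      also have "\<dots> = shift T m \<cdot> e' \<cdot> (\<iota> i \<cdot> a i) \<cdot> b i"
        using cmp_assoc[OF b[OF i] cmp_hom[OF a[OF i] \<iota>[OF i]] cmp_hom[OF e' sm]] .
      also have "\<dots> = shift T m \<cdot> shift T (\<kappa> i) \<cdot> b i"
        using cmp_assoc[OF cmp_hom[OF a[OF i] \<iota>[OF i]] e' sm] s\<kappa>[OF i] by simp
      also have "\<dots> = shift T (g i) \<cdot> b i"
        using shift_cmp[OF \<kappa>[OF i] m(1)] m(2) i by simp
      finally show ?thesis .
    qed
    have "shift T k \<cdot> e' = shift T l \<cdot> e'"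
      by (rule coproduct_hom_eqI[OF P, of _ "shift_obj T W"])
        (use * k l cmp_hom[OF e' shift_hom] in auto)
    moreover have "shift T m \<cdot> e' \<cdot> e = shift T m" if "m \<in> homset T Q W" for m
      using cmp_assoc[OF e e' shift_hom[OF that]] e'e cmp_ident_right[OF shift_hom[OF that]] by simp
    ultimately show "k = l"
      using shift_faithful k l by metis
  qed
  then have "is_coproduct T I Y Q \<kappa>"
    unfolding is_coproduct_def using Q \<kappa> by blast
  then show ?thesis
    using that Y a iso e\<kappa> by blast
qed

text \<open>Desuspend the coproduct P to Q. A morphism from the shift of A to P then comes from some
  A \<rightarrow> Q, which is a finite sum, and shifting back preserves finite sums.\<close>

lemma compact_shift:
  assumes A: "compact_object T (U :: 'u set) A"
  shows "compact_object T U (shift_obj T A)"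
  unfolding compact_object_iff
proof (intro conjI allI impI subsetI)
  have Ao: "A \<in> obj T"
    using A unfolding compact_object_iff by blast
  then show sA: "shift_obj T A \<in> obj T"
    by (rule shift_obj_closed)
  fix I :: "'u set" and X P \<iota> h
  assume I: "I \<prec> U" and X: "\<forall>i\<in>I. X i \<in> obj T" and P: "is_coproduct T I X P \<iota>"
    and h: "h \<in> homset T (shift_obj T A) P"
  obtain Y Q \<kappa> a e where Q: "is_coproduct T I Y Q \<kappa>" and Y: "\<And>i. i \<in> I \<Longrightarrow> Y i \<in> obj T"
    and a: "\<And>i. i \<in> I \<Longrightarrow> a i \<in> homset T (shift_obj T (Y i)) (X i)"
    and iso: "is_isomorphism T (shift_obj T Q) P e"
    and e\<kappa>: "\<And>i. i \<in> I \<Longrightarrow> e \<cdot> shift T (\<kappa> i) = \<iota> i \<cdot> a i"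
    using coproduct_desuspension[OF P] X by metis
  obtain e' where e: "e \<in> homset T (shift_obj T Q) P" and e': "e' \<in> homset T P (shift_obj T Q)"
    and ee': "e \<cdot> e' = ident T P"
    using iso unfolding is_isomorphism_def by blast
  have Q': "Q \<in> obj T" and \<kappa>: "\<And>i. i \<in> I \<Longrightarrow> \<kappa> i \<in> homset T (Y i) Q"
    using Q unfolding is_coproduct_def by blast+
  have \<iota>: "\<And>i. i \<in> I \<Longrightarrow> \<iota> i \<in> homset T (X i) P"
    using P unfolding is_coproduct_def by blast+
  have "e \<cdot> shift T m \<in> finite_sums T I X P \<iota> (shift_obj T A)" if "m \<in> finite_sums T I Y Q \<kappa> A" for m
    using that
  proof induction
    case zero
    have "e \<cdot> shift T (hzero T A Q) = hzero T (shift_obj T A) P"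
      using shift_hzero[OF Ao Q'] cmp_hzero_right[OF e sA] by simp
    then show ?case
      by (simp add: finite_sums.zero)
  next
    case (single i b)
    have "e \<cdot> shift T (\<kappa> i \<cdot> b) = \<iota> i \<cdot> (a i \<cdot> shift T b)"
      using shift_cmp[OF single(2) \<kappa>[OF single(1)]] e\<kappa>[OF single(1)]
        cmp_assoc[OF shift_hom[OF single(2)] shift_hom[OF \<kappa>[OF single(1)]] e]
        cmp_assoc[OF shift_hom[OF single(2)] a[OF single(1)] \<iota>[OF single(1)]] by simp
    moreover have "a i \<cdot> shift T b \<in> homset T (shift_obj T A) (X i)"
      using cmp_hom[OF shift_hom[OF single(2)] a[OF single(1)]] .
    ultimately show ?case
      by (simp add: finite_sums.single[where X = X, OF single(1)])
  next
    case (plus f g)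
    have fg: "f \<in> homset T A Q" "g \<in> homset T A Q"
      using finite_sums_hom[OF _ Q Ao] plus.hyps by blast+
    have "e \<cdot> shift T (f \<boxplus> g) = e \<cdot> shift T f \<boxplus> e \<cdot> shift T g"
      using shift_hplus[OF fg] cmp_hplus_right[OF shift_hom[OF fg(1)] shift_hom[OF fg(2)] e] by simp
    then show ?case
      using finite_sums.plus[OF plus.IH] by simp
  qed
  \<comment> \<open>The desuspension of h, after moving its target from P to the shift of Q.\<close>
  moreover obtain m where m: "m \<in> homset T A Q" "shift T m = e' \<cdot> h"
    using shift_full[OF cmp_hom[OF h e'] Ao Q'] by blast
  moreover have "m \<in> finite_sums T I Y Q \<kappa> A"
    using A I Y Q m(1) unfolding compact_object_iff by blast
  moreover have "e \<cdot> shift T m = h"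
    using m(2) cmp_assoc[OF h e' e] ee' cmp_ident_left[OF h] by simp
  ultimately show "h \<in> finite_sums T I X P \<iota> (shift_obj T A)"
    by metis
qed

text \<open>Given \<open>h : C \<rightarrow> P\<close>, the finitely supported \<open>h \<cdot> v\<close> is fixed by a finitely supported
  endomorphism \<open>e\<close> of \<open>P\<close>; the difference \<open>h - e \<cdot> h\<close> kills \<open>v\<close>, so it factors through the
  compact object \<open>\<Sigma>A\<close>.\<close>

lemma compact_cone:
  assumes tri: "(u, v, w) \<in> triangles T" and u: "u \<in> homset T A B" and v: "v \<in> homset T B C"
    and A: "compact_object T (U :: 'u set) A" and B: "compact_object T U B"
  shows "compact_object T U C"
  unfolding compact_object_iff
proof (intro conjI allI impI subsetI)
  show C: "C \<in> obj T"
    using homset_obj v by blast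
  fix I :: "'u set" and X P \<iota> h
  assume I: "I \<prec> U" and X: "\<forall>i\<in>I. X i \<in> obj T" and P: "is_coproduct T I X P \<iota>"
    and h: "h \<in> homset T C P"
  have w: "w \<in> homset T C (shift_obj T A)"
    using triangle_arrows[OF tri] u v unfolding homset_def by auto
  \<comment> \<open>The rotated triangle makes w a weak cokernel of v.\<close>
  have rot: "(v, w, hneg T (shift T u)) \<in> triangles T"
    using TR2[OF u v w] tri by blast
  have Bo: "B \<in> obj T"
    using homset_obj v by blast
  have hv: "h \<cdot> v \<in> homset T B P"
    using cmp_hom[OF v h] .
  have "h \<cdot> v \<in> finite_sums T I X P \<iota> B"
    using B I X P hv unfolding compact_object_iff by blast
  then obtain e where e: "e \<in> finite_sums T I X P \<iota> P" "e \<cdot> (h \<cdot> v) = h \<cdot> v"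
    using finite_sums_fixed[OF _ P Bo] X by blast
  have eP: "e \<in> homset T P P"
    using finite_sums_hom[OF e(1) P] homset_obj h by blast
  have eh: "e \<cdot> h \<in> homset T C P"
    using cmp_hom[OF h eP] .
  obtain k where k: "k \<in> homset T C P" "h = k \<boxplus> e \<cdot> h"
    using hplus_ex_difference[OF h eh] by blast
  have "h \<cdot> v = (k \<boxplus> e \<cdot> h) \<cdot> v"
    using k(2) by simp
  also have "\<dots> = k \<cdot> v \<boxplus> h \<cdot> v"
    using cmp_hplus_left[OF v k(1) eh] cmp_assoc[OF v h eP] e(2) by simp
  finally have "hzero T B P \<boxplus> h \<cdot> v = k \<cdot> v \<boxplus> h \<cdot> v"
    using hplus_hzero[OF hv] by simp
  then have "k \<cdot> v = hzero T B P"
    using hplus_right_cancel[OF hzero_hom cmp_hom[OF v k(1)] hv] homset_obj[OF hv] by simp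
  then obtain l where l: "l \<in> homset T (shift_obj T A) P" "l \<cdot> w = k"
    using triangle_weak_cokernel[OF rot v w k(1)] by blast
  have "l \<in> finite_sums T I X P \<iota> (shift_obj T A)"
    using compact_shift[OF A] I X P l(1) unfolding compact_object_iff by blast
  then have "k \<in> finite_sums T I X P \<iota> C"
    using finite_sums_cmp[OF _ P w] l(2) by metis
  \<comment> \<open>In h = k + e \<cdot> h the second summand is a finite sum because e is
    one.\<close>
  then show "h \<in> finite_sums T I X P \<iota> C"
    using finite_sums.plus finite_sums_cmp[OF e(1) P h] k(2) by metis
qed

end

section \<open>Solutions of pp formulas\<close>

definition solves ::
  "('o, 'm, 'z) preadditive_precategory_scheme \<Rightarrow> 'o \<Rightarrow> ('o pp_var \<Rightarrow> 'm) \<Rightarrow>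
   (('o, 'm) pp_term \<times> ('o, 'm) pp_term) list \<Rightarrow> bool" where
  "solves T X v es \<longleftrightarrow> (\<forall>(s, t)\<in>set es. eval_term T X v s = eval_term T X v t)"

lemma solves_simps [simp]:
  "solves T X v []"
  "solves T X v ((s, t) # es) \<longleftrightarrow> eval_term T X v s = eval_term T X v t \<and> solves T X v es"
  by (simp_all add: solves_def)

lemma eval_term_cong:
  "(\<And>y. y \<in> term_vars t \<Longrightarrow> v y = w y) \<Longrightarrow> eval_term T X v t = eval_term T X w t"
  by (induction t) auto

text \<open>\<open>satisfies\<close> may change the values of bound variables only, and x is not
  bound. Hence a single valuation of all variables witnesses both the value at x and the
  equations.\<close>

lemma solutions_PP:
  assumes "x \<notin> set ys" and "fst x \<in> S"
  shows "solutions T S x (PP ys es) X = {w x | w. valuation T S X w \<and> solves T X w es}"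
proof (intro equalityI subsetI)
  fix a assume "a \<in> solutions T S x (PP ys es) X"
  then obtain w where "valuation T S X w" "w x = a" "solves T X w es"
    using assms(1) unfolding solutions_def solves_def by (cases x) auto
  then show "a \<in> {w x | w. valuation T S X w \<and> solves T X w es}"
    by blast
next
  fix a assume "a \<in> {w x | w. valuation T S X w \<and> solves T X w es}"
  then obtain w where w: "a = w x" "valuation T S X w" "solves T X w es"
    by blast
  then have "a \<in> homset T (fst x) X"
    using assms(2) unfolding valuation_def by blast
  moreover have "satisfies T S X w (PP ys es)"
    using w unfolding solves_def by auto
  ultimately show "a \<in> solutions T S x (PP ys es) X"
    using w unfolding solutions_def by blast
qed

context additive_category
begin

lemma eval_term_hom:
  assumes "wf_term T S t" and "valuation T S X v" and "S \<subseteq> obj T" and "X \<in> obj T"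
  shows "eval_term T X v t \<in> homset T (term_sort T t) X"
  using assms
  by (induction t) (auto simp: valuation_def intro: hzero_hom hplus_hom cmp_hom)

text \<open>Function symbols act by precomposition and g by postcomposition, so associativity and
  additivity make every term natural in X.\<close>

lemma eval_term_cmp:
  assumes "wf_term T S t" and v: "valuation T S X v" and S: "S \<subseteq> obj T" and g: "g \<in> homset T X Y"
  shows "eval_term T Y (\<lambda>x. g \<cdot> v x) t = g \<cdot> eval_term T X v t"
  using assms(1)
proof (induction t)
  case (Zero A)
  then show ?case
    using cmp_hzero_right[OF g] S by auto
next
  case (Plus s t)
  then have "eval_term T X v s \<in> homset T (term_sort T s) X"
    and "eval_term T X v t \<in> homset T (term_sort T s) X"
    using eval_term_hom[OF _ v S homset_obj(1)[OF g]] by (auto, metis)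
  then show ?case
    using Plus cmp_hplus_right[OF _ _ g] by auto
next
  case (App f t)
  then have "eval_term T X v t \<in> homset T (term_sort T t) X"
    using eval_term_hom[OF _ v S homset_obj(1)[OF g]] by auto
  then show ?case
    using App cmp_assoc[OF _ _ g] by auto
qed simp

lemma valuation_cmp:
  assumes "valuation T S X v" and "g \<in> homset T X Y"
  shows "valuation T S Y (\<lambda>x. g \<cdot> v x)"
  using assms cmp_hom unfolding valuation_def by blast

lemma solves_cmp:
  assumes "solves T X v es" and "\<And>s t. (s, t) \<in> set es \<Longrightarrow> wf_term T S s \<and> wf_term T S t"
    and "valuation T S X v" and "S \<subseteq> obj T" and "g \<in> homset T X Y"
  shows "solves T Y (\<lambda>x. g \<cdot> v x) es"
  unfolding solves_def
proof clarify
  fix s t assume st: "(s, t) \<in> set es"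
  then have "eval_term T X v s = eval_term T X v t"
    using assms(1) unfolding solves_def by blast
  then show "eval_term T Y (\<lambda>x. g \<cdot> v x) s = eval_term T Y (\<lambda>x. g \<cdot> v x) t"
    using assms(2)[OF st] eval_term_cmp[OF _ assms(3-5)] by simp
qed

text \<open>A morphism g carries the values of the bound variables along with that of x, so the
  composed valuation is again a witness.\<close>

lemma solutions_cmp:
  assumes "pp_formula_in T S x \<psi>" and "a \<in> solutions T S x \<psi> X" and "S \<subseteq> obj T"
    and g: "g \<in> homset T X Y"
  shows "g \<cdot> a \<in> solutions T S x \<psi> Y"
proof (cases \<psi>)
  case (PP ys es)
  with assms(1) have x: "x \<notin> set ys" "fst x \<in> S"
    and wf: "\<And>s t. (s, t) \<in> set es \<Longrightarrow> wf_term T S s \<and> wf_term T S t"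
    by auto
  from assms(2) obtain w where w: "a = w x" "valuation T S X w" "solves T X w es"
    unfolding PP solutions_PP[OF x] by blast
  show ?thesis
    unfolding PP solutions_PP[OF x] w(1)
    using valuation_cmp[OF w(2) g] solves_cmp[OF w(3) wf w(2) assms(3) g]
    by (intro CollectI exI[of _ "\<lambda>x. g \<cdot> w x"]) simp
qed

lemma solutions_divides_formula:
  assumes f: "f \<in> homset T A B" and A: "A \<in> S" and B: "B \<in> S" and "S \<subseteq> obj T" and "X \<in> obj T"
  shows "solutions T S (A, n) (divides_formula T f (A, n)) X = {g \<cdot> f | g. g \<in> homset T B X}"
proof -
  have tB: "tgt T f = B"
    using f unfolding homset_def by simp
  have "divides_formula T f (A, n) = PP [(B, Suc n)] [(Var (A, n), App f (Var (B, Suc n)))]"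
    by (simp add: divides_formula_def tB Let_def)
  then have sol: "solutions T S (A, n) (divides_formula T f (A, n)) X =
      {w (A, n) | w. valuation T S X w \<and> w (A, n) = w (B, Suc n) \<cdot> f}"
    using A by (simp add: solutions_PP)
  have "\<exists>w. valuation T S X w \<and> w (A, n) = g \<cdot> f \<and> w (B, Suc n) = g" if "g \<in> homset T B X" for g
  proof (intro exI conjI)
    \<comment> \<open>Valuations assign values to all variables with sorts in S, hence the default
      0. The index \<open>Suc n\<close> keeps the two variables apart even when A = B.\<close>
    show "valuation T S X (\<lambda>z. if z = (A, n) then g \<cdot> f else if z = (B, Suc n) then g else hzero T (fst z) X)"
      using that f cmp_hom hzero_hom assms(4,5) unfolding valuation_def by auto
  qed auto
  moreover have "w (B, Suc n) \<in> homset T B X" if "valuation T S X w" for w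
    using that B unfolding valuation_def by auto
  ultimately show ?thesis
    unfolding sol by (auto, metis)
qed

end

section \<open>Weakly universal solutions in compact objects\<close>

context triangulated_category
begin

text \<open>The case without equations: Y is a biproduct of the sorts of V, with one summand added
  per variable, and v consists of the injections. Weakness means that h is not claimed to be
  unique.\<close>

lemma ex_weakly_universal_valuation:
  assumes S: "\<And>B. B \<in> S \<Longrightarrow> compact_object T (U :: 'u set) B" and "A \<in> S"
    and "finite V" and "\<And>y. y \<in> V \<Longrightarrow> fst y \<in> S"
  shows "\<exists>Y v. compact_object T U Y \<and> valuation T S Y v \<and>
    (\<forall>X\<in>obj T. \<forall>w. valuation T S X w \<longrightarrow> (\<exists>h\<in>homset T Y X. \<forall>y\<in>V. w y = h \<cdot> v y))"
  using assms(3,4)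
proof (induction V)
  \<comment> \<open>With no variables to match, any compact object will do; A is at hand, with the
    zero valuation.\<close>
  case empty
  have "B \<in> obj T" if "B \<in> S" for B
    using S[OF that] unfolding compact_object_def by blast
  then show ?case
    using S[OF \<open>A \<in> S\<close>] hzero_hom \<open>A \<in> S\<close> unfolding valuation_def
    by (intro exI[of _ A] exI[of _ "\<lambda>x. hzero T (fst x) A"]) blast
next
  case (insert y V)
  then obtain Y v where Y: "compact_object T U Y" and v: "valuation T S Y v"
    and univ: "\<And>X w. X \<in> obj T \<Longrightarrow> valuation T S X w \<Longrightarrow> \<exists>h\<in>homset T Y X. \<forall>y\<in>V. w y = h \<cdot> v y"
    by blast
  define B where "B = fst y"
  have BS: "B \<in> S"
    using insert.prems unfolding B_def by blast
  have Yo: "Y \<in> obj T" and Bo: "B \<in> obj T"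
    using Y S[OF BS] unfolding compact_object_def by blast+
  obtain P i j p q where P: "P \<in> obj T" and i: "i \<in> homset T Y P" and j: "j \<in> homset T B P"
    and p: "p \<in> homset T P Y" and q: "q \<in> homset T P B"
    and eqs: "p \<cdot> i = ident T Y" "q \<cdot> j = ident T B" "q \<cdot> i = hzero T Y B" "p \<cdot> j = hzero T B Y"
      "i \<cdot> p \<boxplus> j \<cdot> q = ident T P"
    using ex_biproduct[OF Yo Bo] by blast
  \<comment> \<open>The new variable becomes the new injection; the earlier values are pushed
    forward along the other.\<close>
  let ?v = "\<lambda>z. if z = y then j else i \<cdot> v z"
  have "compact_object T U P"
    using compact_biproduct[OF Y S[OF BS] P p q i j eqs(5)] .
  moreover have "valuation T S P ?v"
    using valuation_cmp[OF v i] j B_def unfolding valuation_def by auto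
  moreover have "\<exists>h\<in>homset T P X. \<forall>z\<in>insert y V. w z = h \<cdot> ?v z"
    if X: "X \<in> obj T" and w: "valuation T S X w" for X w
  proof -
    obtain h where h: "h \<in> homset T Y X" "\<And>z. z \<in> V \<Longrightarrow> w z = h \<cdot> v z"
      using univ[OF X w] by blast
    have wy: "w y \<in> homset T B X"
      using w BS unfolding valuation_def B_def by blast
    \<comment> \<open>The morphism out of the biproduct with components h and w y.\<close>
    let ?h = "h \<cdot> p \<boxplus> w y \<cdot> q"
    have hp: "h \<cdot> p \<in> homset T P X" and wq: "w y \<cdot> q \<in> homset T P X"
      using cmp_hom p q h(1) wy by blast+
    then have hh: "?h \<in> homset T P X"
      by (rule hplus_hom)
    have "?h \<cdot> j = h \<cdot> (p \<cdot> j) \<boxplus> w y \<cdot> (q \<cdot> j)"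
      using cmp_hplus_left[OF j hp wq] cmp_assoc[OF j p h(1)] cmp_assoc[OF j q wy] by simp
    also have "\<dots> = w y"
      using eqs cmp_hzero_right[OF h(1) Bo] cmp_ident_right[OF wy] hplus_hzero[OF wy] by simp
    finally have hj: "?h \<cdot> j = w y" .
    have "?h \<cdot> i = h \<cdot> (p \<cdot> i) \<boxplus> w y \<cdot> (q \<cdot> i)"
      using cmp_hplus_left[OF i hp wq] cmp_assoc[OF i p h(1)] cmp_assoc[OF i q wy] by simp
    also have "\<dots> = h"
      using eqs cmp_hzero_right[OF wy Yo] cmp_ident_right[OF h(1)] hplus_hzero[OF h(1)] by simp
    finally have hi: "?h \<cdot> i = h" .
    have "w z = ?h \<cdot> (i \<cdot> v z)" if "z \<in> V" for z
    proof -
      have "v z \<in> homset T (fst z) Y"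
        using v insert.prems that unfolding valuation_def by blast
      then show ?thesis
        using cmp_assoc[OF _ i hh] hi h(2)[OF that] by simp
    qed
    then have "w z = ?h \<cdot> ?v z" if "z \<in> insert y V" for z
      using that by (cases "z = y") (simp_all only: hj insert_iff if_True if_False refl simp_thms)
    then have "\<forall>z\<in>insert y V. w z = ?h \<cdot> ?v z"
      by (rule ballI)
    then show ?thesis
      using hh by (intro bexI[of _ ?h])
  qed
  ultimately show ?case
    by (intro exI[of _ P] exI[of _ ?v] conjI ballI allI impI)
qed

text \<open>Each equation \<open>s = t\<close> is imposed by passing to the cone of \<open>s - t\<close>, evaluated at the
  weakly universal solution of the preceding ones.\<close>

lemma ex_weakly_universal_solution:
  assumes S: "\<And>B. B \<in> S \<Longrightarrow> compact_object T (U :: 'u set) B" and "A \<in> S"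
    and "finite V" and V: "\<And>y. y \<in> V \<Longrightarrow> fst y \<in> S"
    and "\<And>s t. (s, t) \<in> set es \<Longrightarrow> wf_term T S s \<and> wf_term T S t \<and> term_sort T s = term_sort T t \<and>
        term_vars s \<union> term_vars t \<subseteq> V"
  shows "\<exists>Y v. compact_object T U Y \<and> valuation T S Y v \<and> solves T Y v es \<and>
    (\<forall>X\<in>obj T. \<forall>w. valuation T S X w \<and> solves T X w es \<longrightarrow> (\<exists>h\<in>homset T Y X. \<forall>y\<in>V. w y = h \<cdot> v y))"
  using assms(5)
proof (induction es)
  case Nil
  show ?case
    using ex_weakly_universal_valuation[OF S assms(2-4)] by auto
next
  case (Cons e es)
  obtain s t where e: "e = (s, t)"
    by (cases e)
  have S_obj: "S \<subseteq> obj T"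
    using S unfolding compact_object_def by blast
  have wf: "wf_term T S s" "wf_term T S t" "term_sort T s = term_sort T t"
    and vars: "term_vars s \<subseteq> V" "term_vars t \<subseteq> V"
    using Cons.prems[of s t] e by auto
  obtain Y v where Y: "compact_object T U Y" and v: "valuation T S Y v" and vs: "solves T Y v es"
    and univ: "\<And>X w. X \<in> obj T \<Longrightarrow> valuation T S X w \<Longrightarrow> solves T X w es \<Longrightarrow>
        \<exists>h\<in>homset T Y X. \<forall>y\<in>V. w y = h \<cdot> v y"
    using Cons.IH Cons.prems by (metis (lifting) list.set_intros(2))
  have Yo: "Y \<in> obj T"
    using Y unfolding compact_object_def by blast
  define C where "C = term_sort T t"
  have st: "eval_term T Y v s \<in> homset T C Y" "eval_term T Y v t \<in> homset T C Y"
    using eval_term_hom[OF _ v S_obj Yo] wf unfolding C_def by metis+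
  have sort_S: "term_sort T r \<in> S" if "wf_term T S r" for r
    using that by (induction r) auto
  then have C: "compact_object T U C"
    using S wf(2) unfolding C_def by blast
  obtain d where d: "d \<in> homset T C Y"
      "\<And>X h. h \<in> homset T Y X \<Longrightarrow>
        h \<cdot> d = hzero T C X \<longleftrightarrow> h \<cdot> eval_term T Y v s = h \<cdot> eval_term T Y v t"
    using ex_equalising_difference[OF st] by blast
  obtain c c' where tri: "(d, c, c') \<in> triangles T"
    using TR1_cone d(1) unfolding homset_def by blast
  obtain Z where c: "c \<in> homset T Y Z" and c': "c' \<in> homset T Z (shift_obj T C)"
    using triangle_arrows[OF tri] d(1) unfolding homset_def by auto
  \<comment> \<open>The image of v in the cone Z of d. The earlier equations persist by naturality,
    and the new one holds because c \<cdot> d = 0.\<close>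
  let ?v = "\<lambda>x. c \<cdot> v x"
  have "compact_object T U Z"
    using compact_cone[OF tri d(1) c C Y] .
  moreover have "valuation T S Z ?v"
    using valuation_cmp[OF v c] .
  moreover have "solves T Z ?v (e # es)"
  proof -
    have "c \<cdot> d = hzero T C Z"
      using triangle_cmp_zero[OF tri d(1) c] .
    then have "c \<cdot> eval_term T Y v s = c \<cdot> eval_term T Y v t"
      using d(2)[OF c] by blast
    then show ?thesis
      using eval_term_cmp[OF wf(1) v S_obj c] eval_term_cmp[OF wf(2) v S_obj c]
        solves_cmp[OF vs _ v S_obj c] Cons.prems unfolding e by auto
  qed
  moreover have "\<exists>h\<in>homset T Z X. \<forall>y\<in>V. w y = h \<cdot> (c \<cdot> v y)"
    if X: "X \<in> obj T" and w: "valuation T S X w" and ws: "solves T X w (e # es)" for X w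
  proof -
    obtain h where h: "h \<in> homset T Y X" "\<And>y. y \<in> V \<Longrightarrow> w y = h \<cdot> v y"
      using univ[OF X w] ws unfolding e by auto
    \<comment> \<open>As w and h \<cdot> v agree on V, they agree on both sides of the new equation.
      So h kills d and factors through the cone.\<close>
    have "eval_term T X w r = h \<cdot> eval_term T Y v r" if "wf_term T S r" "term_vars r \<subseteq> V" for r
      using eval_term_cmp[OF that(1) v S_obj h(1)] eval_term_cong[of r w "\<lambda>x. h \<cdot> v x" T X] h(2) that(2)
      by auto
    then have "h \<cdot> d = hzero T C X"
      using d(2)[OF h(1)] wf vars ws unfolding e by simp
    then obtain k where k: "k \<in> homset T Z X" "k \<cdot> c = h"
      using triangle_weak_cokernel[OF tri d(1) c h(1)] by blast
    have "w y = k \<cdot> (c \<cdot> v y)" if "y \<in> V" for y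
      using h(2)[OF that] k(2) cmp_assoc[OF _ c k(1), of "v y" "fst y"] v V[OF that]
      unfolding valuation_def by simp
    with k(1) show ?thesis
      by blast
  qed
  ultimately show ?case
    by blast
qed

end

section \<open>Representing morphisms of pp formulas and free realisations\<close>

theorem corollary2p14:
  fixes T :: "('o, 'm, 'z) pretriangulation_scheme"
    and U :: "'u set" and S :: "'o set"
    and A :: 'o and n :: nat and \<phi> :: "('o, 'm) pp_formula"
  assumes "compactly_generated_triangulated_category T U"
    and "small_version_of_compacts T U S"
    and "A \<in> S"
    and "pp_formula_in T S (A, n) \<phi>"
  shows "(\<exists>B\<in>S. \<exists>f\<in>homset T A B.
            pp_equivalent T S (A, n) \<phi> (divides_formula T f (A, n))) \<and>
         (\<forall>B\<in>S. \<forall>f\<in>homset T A B.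
            pp_equivalent T S (A, n) \<phi> (divides_formula T f (A, n)) \<longrightarrow>
            free_realisation T U S (A, n) \<phi> B f)"
proof (intro conjI ballI impI)
  interpret compactly_generated_triangulated_category T U
    by fact
  have S: "\<And>B. B \<in> S \<Longrightarrow> compact_object T U B"
    and S_ess: "\<And>Y. compact_object T U Y \<Longrightarrow> \<exists>B\<in>S. isomorphic T Y B"
    using assms(2) unfolding small_version_of_compacts_def by blast+
  have S_obj: "S \<subseteq> obj T"
    using S unfolding compact_object_def by blast
  show "\<exists>B\<in>S. \<exists>f\<in>homset T A B. pp_equivalent T S (A, n) \<phi> (divides_formula T f (A, n))"
  proof (cases \<phi>)
    case (PP ys es)
    let ?V = "insert (A, n) (set ys)"
    have V: "\<And>y. y \<in> ?V \<Longrightarrow> fst y \<in> S" and x: "(A, n) \<notin> set ys" "fst (A, n) \<in> S"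
      and wf: "\<And>s t. (s, t) \<in> set es \<Longrightarrow> wf_term T S s \<and> wf_term T S t \<and>
        term_sort T s = term_sort T t \<and> term_vars s \<union> term_vars t \<subseteq> ?V"
      using assms(4) unfolding PP by auto
    obtain Y v where Y: "compact_object T U Y" and v: "valuation T S Y v" and vs: "solves T Y v es"
      and univ: "\<And>X w. X \<in> obj T \<Longrightarrow> valuation T S X w \<Longrightarrow> solves T X w es \<Longrightarrow>
          \<exists>h\<in>homset T Y X. \<forall>y\<in>?V. w y = h \<cdot>\<^bsub>T\<^esub> v y"
      using ex_weakly_universal_solution[OF S assms(3) _ V wf] by (metis (lifting) List.finite_set finite_insert)
    \<comment> \<open>The weakly universal object is compact but may lie outside S, so it is
      replaced by an isomorphic object of S.\<close>
    obtain B e e' where B: "B \<in> S" and e: "e \<in> homset T Y B" and e': "e' \<in> homset T B Y"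
      and e'e: "e' \<cdot>\<^bsub>T\<^esub> e = ident T Y"
      using S_ess[OF Y] unfolding isomorphic_def is_isomorphism_def by blast
    have vx: "v (A, n) \<in> homset T A Y"
      using v assms(3) unfolding valuation_def by auto
    define f where "f = e \<cdot>\<^bsub>T\<^esub> v (A, n)"
    have f: "f \<in> homset T A B"
      using cmp_hom[OF vx e] unfolding f_def .
    have "solutions T S (A, n) \<phi> X = {g \<cdot>\<^bsub>T\<^esub> f | g. g \<in> homset T B X}" if X: "X \<in> obj T" for X
    proof (intro equalityI subsetI)
      fix a assume "a \<in> solutions T S (A, n) \<phi> X"
      then obtain w where w: "a = w (A, n)" "valuation T S X w" "solves T X w es"
        unfolding PP solutions_PP[OF x] by blast
      then obtain h where h: "h \<in> homset T Y X" "a = h \<cdot>\<^bsub>T\<^esub> v (A, n)"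
        using univ[OF X w(2,3)] by auto
      \<comment> \<open>The factor exhibiting a as a multiple of f is h \<cdot> e'.\<close>
      have "h \<cdot>\<^bsub>T\<^esub> e' \<cdot>\<^bsub>T\<^esub> f = a"
        using cmp_assoc[OF f e' h(1)] cmp_assoc[OF vx e e'] e'e cmp_ident_left[OF vx] h(2)
        unfolding f_def by simp
      then show "a \<in> {g \<cdot>\<^bsub>T\<^esub> f | g. g \<in> homset T B X}"
        using cmp_hom[OF e' h(1)] by blast
    next
      fix a assume "a \<in> {g \<cdot>\<^bsub>T\<^esub> f | g. g \<in> homset T B X}"
      then obtain g where g: "g \<in> homset T B X" "a = g \<cdot>\<^bsub>T\<^esub> f"
        by blast
      have "v (A, n) \<in> solutions T S (A, n) \<phi> Y"
        unfolding PP solutions_PP[OF x] using v vs by blast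
      then have "g \<cdot>\<^bsub>T\<^esub> e \<cdot>\<^bsub>T\<^esub> v (A, n) \<in> solutions T S (A, n) \<phi> X"
        using solutions_cmp[OF assms(4) _ S_obj cmp_hom[OF e g(1)]] by blast
      then show "a \<in> solutions T S (A, n) \<phi> X"
        using g(2) cmp_assoc[OF vx e g(1)] unfolding f_def by simp
    qed
    then have "pp_equivalent T S (A, n) \<phi> (divides_formula T f (A, n))"
      unfolding pp_equivalent_def by (simp add: solutions_divides_formula[OF f assms(3) B S_obj])
    then show ?thesis
      using B f by blast
  qed
next
  fix B f
  interpret compactly_generated_triangulated_category T U
    by fact
  assume B: "B \<in> S" and f: "f \<in> homset T A B"
    and equiv: "pp_equivalent T S (A, n) \<phi> (divides_formula T f (A, n))"
  have S: "\<And>B. B \<in> S \<Longrightarrow> compact_object T U B"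
    using assms(2) unfolding small_version_of_compacts_def by blast
  then have S_obj: "S \<subseteq> obj T"
    unfolding compact_object_def by blast
  have sol: "solutions T S (A, n) \<phi> X = {g \<cdot>\<^bsub>T\<^esub> f | g. g \<in> homset T B X}" if "X \<in> obj T" for X
    using equiv that unfolding pp_equivalent_def
    by (simp add: solutions_divides_formula[OF f assms(3) B S_obj])
  have Bo: "B \<in> obj T"
    using B S_obj by blast
  have f_sol: "f \<in> solutions T S (A, n) \<phi> B"
    unfolding sol[OF Bo] using ident_hom[OF Bo] cmp_ident_left[OF f] by force
  \<comment> \<open>Testing \<phi> \<le> \<psi> on the single element f suffices: f satisfies
    \<phi>, and every other element of \<phi>(X) is an image g \<cdot> f of it.\<close>
  have "pp_le T S (A, n) \<phi> \<psi> \<longleftrightarrow> f \<in> solutions T S (A, n) \<psi> B" if \<psi>: "pp_formula_in T S (A, n) \<psi>" for \<psi>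
  proof
    show "f \<in> solutions T S (A, n) \<psi> B" if "pp_le T S (A, n) \<phi> \<psi>"
      using that Bo f_sol unfolding pp_le_def by (meson subsetD)
    show "pp_le T S (A, n) \<phi> \<psi>" if "f \<in> solutions T S (A, n) \<psi> B"
      unfolding pp_le_def
    proof (intro ballI subsetI)
      fix X a
      assume "X \<in> obj T" and "a \<in> solutions T S (A, n) \<phi> X"
      then obtain g where "g \<in> homset T B X" and "a = g \<cdot>\<^bsub>T\<^esub> f"
        unfolding sol[OF \<open>X \<in> obj T\<close>] by fast
      then show "a \<in> solutions T S (A, n) \<psi> X"
        using solutions_cmp[OF \<psi> that S_obj] by simp
    qed
  qed
  then show "free_realisation T U S (A, n) \<phi> B f"
    using S[OF B] f unfolding free_realisation_def pp_type_def pp_filter_def by auto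
qed

end
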